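(* Let $0\le k\le n$ be integers. The number of model structures on the category $[n]$ whose homotopy category is equivalent to the category $[k]$ is exactly $$\frac{2(k+1)}{n+k+2}\binom{2n+1}{n-k}.$$
   Context: $[n]$ denotes the poset $\{0<1<\dots<n\}$ regarded as a category: there is a unique morphism $i\to j$ if $i\le j$ and none otherwise. A weak factorization system on a category $\mathcal C$ is a pair $(\mathcal L,\mathcal R)$ of classes of morphisms such that every morphism factors as $pi$ with $i\in\mathcal L$, $p\in\mathcal R$; every $i\in\mathcal L$ has the left lifting property with respect to every $p\in\mathcal R$; and $\mathcal L$, $\mathcal R$ are closed under retracts. A model structure on a category $\mathcal C$ with finite limits and colimits is a triple $(\mathsf W,\mathsf C,\mathsf F)$ of classes of morphisms such that $\mathsf W$ satisfies the 2-out-of-3 property and, with $\mathsf{AF}=\mathsf W\cap\mathsf F$ and $\mathsf{AC}=\mathsf W\cap\mathsf C$, both $(\mathsf C,\mathsf{AF})$ and $(\mathsf{AC},\mathsf F)$ are weak factorization systems. The homotopy category is the localization $\mathcal C[\mathsf W^{-1}]$ obtained by formally inverting the weak equivalences. (For a model structure on $[n]$ it is equivalent to the full subcategory on the objects that are both fibrant and cofibrant.) *)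

theory Defs
  imports Complex_Main
begin

section \<open>Categories, functors, equivalences\<close>

record ('o, 'm) cat =
  Obj :: "'o set"
  Arr :: "'m set"
  Dom :: "'m \<Rightarrow> 'o"
  Cod :: "'m \<Rightarrow> 'o"
  Ident :: "'o \<Rightarrow> 'm"
  Comp :: "'m \<Rightarrow> 'm \<Rightarrow> 'm"

text \<open>Composition is in applicative order: \<^term>\<open>Comp C g f\<close> is ``g after f'',
  and is meaningful only if \<^prop>\<open>Cod C f = Dom C g\<close>.\<close>

definition Hom :: "('o, 'm) cat \<Rightarrow> 'o \<Rightarrow> 'o \<Rightarrow> 'm set" where
  "Hom C x y = {f \<in> Arr C. Dom C f = x \<and> Cod C f = y}"

definition category :: "('o, 'm) cat \<Rightarrow> bool" where
  "category C \<longleftrightarrow>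
     (\<forall>f \<in> Arr C. Dom C f \<in> Obj C \<and> Cod C f \<in> Obj C) \<and>
     (\<forall>x \<in> Obj C. Ident C x \<in> Hom C x x) \<and>
     (\<forall>x y z f g. f \<in> Hom C x y \<longrightarrow> g \<in> Hom C y z \<longrightarrow> Comp C g f \<in> Hom C x z) \<and>
     (\<forall>x y f. f \<in> Hom C x y \<longrightarrow> Comp C f (Ident C x) = f \<and> Comp C (Ident C y) f = f) \<and>
     (\<forall>w x y z f g h. f \<in> Hom C w x \<longrightarrow> g \<in> Hom C x y \<longrightarrow> h \<in> Hom C y z \<longrightarrow>
        Comp C h (Comp C g f) = Comp C (Comp C h g) f)"

definition opposite :: "('o, 'm) cat \<Rightarrow> ('o, 'm) cat" where
  "opposite C = \<lparr>Obj = Obj C, Arr = Arr C, Dom = Cod C, Cod = Dom C,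
                 Ident = Ident C, Comp = (\<lambda>g f. Comp C f g)\<rparr>"

definition is_functor ::
  "('o, 'm) cat \<Rightarrow> ('p, 'n) cat \<Rightarrow> ('o \<Rightarrow> 'p) \<Rightarrow> ('m \<Rightarrow> 'n) \<Rightarrow> bool" where
  "is_functor C D Fo Fa \<longleftrightarrow>
     (\<forall>x \<in> Obj C. Fo x \<in> Obj D) \<and>
     (\<forall>f \<in> Arr C. Fa f \<in> Hom D (Fo (Dom C f)) (Fo (Cod C f))) \<and>
     (\<forall>x \<in> Obj C. Fa (Ident C x) = Ident D (Fo x)) \<and>
     (\<forall>f \<in> Arr C. \<forall>g \<in> Arr C. Cod C f = Dom C g \<longrightarrow>
        Fa (Comp C g f) = Comp D (Fa g) (Fa f))"

definition is_iso :: "('o, 'm) cat \<Rightarrow> 'm \<Rightarrow> bool" where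
  "is_iso C f \<longleftrightarrow> f \<in> Arr C \<and>
     (\<exists>g \<in> Hom C (Cod C f) (Dom C f).
        Comp C g f = Ident C (Dom C f) \<and> Comp C f g = Ident C (Cod C f))"

definition natural_iso ::
  "('o, 'm) cat \<Rightarrow> ('p, 'n) cat \<Rightarrow> ('o \<Rightarrow> 'p) \<Rightarrow> ('m \<Rightarrow> 'n) \<Rightarrow> ('o \<Rightarrow> 'p) \<Rightarrow> ('m \<Rightarrow> 'n) \<Rightarrow>
   ('o \<Rightarrow> 'n) \<Rightarrow> bool" where
  "natural_iso C D Fo Fa Go Ga \<eta> \<longleftrightarrow>
     (\<forall>x \<in> Obj C. \<eta> x \<in> Hom D (Fo x) (Go x) \<and> is_iso D (\<eta> x)) \<and>
     (\<forall>f \<in> Arr C. Comp D (\<eta> (Cod C f)) (Fa f) = Comp D (Ga f) (\<eta> (Dom C f)))"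

definition equivalent_categories :: "('o, 'm) cat \<Rightarrow> ('p, 'n) cat \<Rightarrow> bool" where
  "equivalent_categories C D \<longleftrightarrow> category C \<and> category D \<and>
     (\<exists>Fo Fa Go Ga \<eta> \<epsilon>. is_functor C D Fo Fa \<and> is_functor D C Go Ga \<and>
        natural_iso C C (Go \<circ> Fo) (Ga \<circ> Fa) id id \<eta> \<and>
        natural_iso D D (Fo \<circ> Go) (Fa \<circ> Ga) id id \<epsilon>)"


section \<open>Finite limits and colimits\<close>

definition is_cone ::
  "('i, 'a) cat \<Rightarrow> ('o, 'm) cat \<Rightarrow> ('i \<Rightarrow> 'o) \<Rightarrow> ('a \<Rightarrow> 'm) \<Rightarrow> 'o \<Rightarrow> ('i \<Rightarrow> 'm) \<Rightarrow> bool" where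
  "is_cone J C Fo Fa x \<phi> \<longleftrightarrow> x \<in> Obj C \<and>
     (\<forall>j \<in> Obj J. \<phi> j \<in> Hom C x (Fo j)) \<and>
     (\<forall>a \<in> Arr J. Comp C (Fa a) (\<phi> (Dom J a)) = \<phi> (Cod J a))"

definition is_limit ::
  "('i, 'a) cat \<Rightarrow> ('o, 'm) cat \<Rightarrow> ('i \<Rightarrow> 'o) \<Rightarrow> ('a \<Rightarrow> 'm) \<Rightarrow> 'o \<Rightarrow> ('i \<Rightarrow> 'm) \<Rightarrow> bool" where
  "is_limit J C Fo Fa x \<phi> \<longleftrightarrow> is_cone J C Fo Fa x \<phi> \<and>
     (\<forall>y \<psi>. is_cone J C Fo Fa y \<psi> \<longrightarrow>
        (\<exists>!u. u \<in> Hom C y x \<and> (\<forall>j \<in> Obj J. Comp C (\<phi> j) u = \<psi> j)))"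

text \<open>Every finite category is isomorphic to one whose objects and arrows are natural
  numbers, so indexing diagrams by such categories loses no generality.\<close>

definition has_finite_limits :: "('o, 'm) cat \<Rightarrow> bool" where
  "has_finite_limits C \<longleftrightarrow>
     (\<forall>(J :: (nat, nat) cat) Fo Fa.
        category J \<and> finite (Obj J) \<and> finite (Arr J) \<and> is_functor J C Fo Fa \<longrightarrow>
        (\<exists>x \<phi>. is_limit J C Fo Fa x \<phi>))"

definition has_finite_colimits :: "('o, 'm) cat \<Rightarrow> bool" where
  "has_finite_colimits C \<longleftrightarrow> has_finite_limits (opposite C)"


section \<open>Weak factorization systems and model structures\<close>

definition has_lifting :: "('o, 'm) cat \<Rightarrow> 'm \<Rightarrow> 'm \<Rightarrow> bool" where
  "has_lifting C i p \<longleftrightarrow>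
     (\<forall>u \<in> Hom C (Dom C i) (Dom C p). \<forall>v \<in> Hom C (Cod C i) (Cod C p).
        Comp C v i = Comp C p u \<longrightarrow>
        (\<exists>d \<in> Hom C (Cod C i) (Dom C p). Comp C d i = u \<and> Comp C p d = v))"

definition retract_of :: "('o, 'm) cat \<Rightarrow> 'm \<Rightarrow> 'm \<Rightarrow> bool" where
  "retract_of C f g \<longleftrightarrow> f \<in> Arr C \<and> g \<in> Arr C \<and>
     (\<exists>a \<in> Hom C (Dom C f) (Dom C g). \<exists>b \<in> Hom C (Cod C f) (Cod C g).
      \<exists>c \<in> Hom C (Dom C g) (Dom C f). \<exists>d \<in> Hom C (Cod C g) (Cod C f).
        Comp C g a = Comp C b f \<and> Comp C f c = Comp C d g \<and>
        Comp C c a = Ident C (Dom C f) \<and> Comp C d b = Ident C (Cod C f))"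

definition retract_closed :: "('o, 'm) cat \<Rightarrow> 'm set \<Rightarrow> bool" where
  "retract_closed C S \<longleftrightarrow> (\<forall>f g. retract_of C f g \<and> g \<in> S \<longrightarrow> f \<in> S)"

definition weak_factorization_system :: "('o, 'm) cat \<Rightarrow> 'm set \<Rightarrow> 'm set \<Rightarrow> bool" where
  "weak_factorization_system C L R \<longleftrightarrow> L \<subseteq> Arr C \<and> R \<subseteq> Arr C \<and>
     (\<forall>f \<in> Arr C. \<exists>i \<in> L. \<exists>p \<in> R. Cod C i = Dom C p \<and> Comp C p i = f) \<and>
     (\<forall>i \<in> L. \<forall>p \<in> R. has_lifting C i p) \<and>
     retract_closed C L \<and> retract_closed C R"

definition two_out_of_three :: "('o, 'm) cat \<Rightarrow> 'm set \<Rightarrow> bool" where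
  "two_out_of_three C W \<longleftrightarrow>
     (\<forall>f \<in> Arr C. \<forall>g \<in> Arr C. Cod C f = Dom C g \<longrightarrow>
        (f \<in> W \<and> g \<in> W \<longrightarrow> Comp C g f \<in> W) \<and>
        (f \<in> W \<and> Comp C g f \<in> W \<longrightarrow> g \<in> W) \<and>
        (g \<in> W \<and> Comp C g f \<in> W \<longrightarrow> f \<in> W))"

definition model_structure ::
  "('o, 'm) cat \<Rightarrow> 'm set \<Rightarrow> 'm set \<Rightarrow> 'm set \<Rightarrow> bool" where
  "model_structure C W Cof Fib \<longleftrightarrow>
     category C \<and> has_finite_limits C \<and> has_finite_colimits C \<and>
     W \<subseteq> Arr C \<and> Cof \<subseteq> Arr C \<and> Fib \<subseteq> Arr C \<and>
     two_out_of_three C W \<and>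
     weak_factorization_system C Cof (W \<inter> Fib) \<and>
     weak_factorization_system C (W \<inter> Cof) Fib"


section \<open>Localization\<close>

text \<open>The localization of \<open>C\<close> at \<open>W\<close> has the objects of \<open>C\<close>. Its morphisms are zigzags, that is,
  paths of arrows of \<open>C\<close> and formal inverses of arrows in \<open>W\<close> (listed in the order in which they
  are traversed), modulo the least congruence which makes the evident map from \<open>C\<close>
  functorial and makes the formal inverses two-sided inverses.\<close>

datatype 'm step = Fwd 'm | Bwd 'm

inductive zigzag :: "('o, 'm) cat \<Rightarrow> 'm set \<Rightarrow> 'o \<Rightarrow> 'm step list \<Rightarrow> 'o \<Rightarrow> bool"
  for C W where
  zigzag_Nil: "x \<in> Obj C \<Longrightarrow> zigzag C W x [] x"
| zigzag_Fwd: "f \<in> Arr C \<Longrightarrow> zigzag C W (Cod C f) us y \<Longrightarrow> zigzag C W (Dom C f) (Fwd f # us) y"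
| zigzag_Bwd: "w \<in> W \<Longrightarrow> zigzag C W (Dom C w) us y \<Longrightarrow> zigzag C W (Cod C w) (Bwd w # us) y"

inductive zigzag_eq ::
  "('o, 'm) cat \<Rightarrow> 'm set \<Rightarrow> 'o \<Rightarrow> 'o \<Rightarrow> 'm step list \<Rightarrow> 'm step list \<Rightarrow> bool"
  for C W where
  zeq_refl: "zigzag C W x us y \<Longrightarrow> zigzag_eq C W x y us us"
| zeq_sym: "zigzag_eq C W x y us vs \<Longrightarrow> zigzag_eq C W x y vs us"
| zeq_trans: "zigzag_eq C W x y us vs \<Longrightarrow> zigzag_eq C W x y vs ws \<Longrightarrow> zigzag_eq C W x y us ws"
| zeq_append: "zigzag_eq C W x y us us' \<Longrightarrow> zigzag_eq C W y z vs vs' \<Longrightarrow>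
     zigzag_eq C W x z (us @ vs) (us' @ vs')"
| zeq_Ident: "x \<in> Obj C \<Longrightarrow> zigzag_eq C W x x [Fwd (Ident C x)] []"
| zeq_Comp: "f \<in> Arr C \<Longrightarrow> g \<in> Arr C \<Longrightarrow> Cod C f = Dom C g \<Longrightarrow>
     zigzag_eq C W (Dom C f) (Cod C g) [Fwd f, Fwd g] [Fwd (Comp C g f)]"
| zeq_Fwd_Bwd: "w \<in> W \<Longrightarrow> zigzag_eq C W (Dom C w) (Dom C w) [Fwd w, Bwd w] []"
| zeq_Bwd_Fwd: "w \<in> W \<Longrightarrow> zigzag_eq C W (Cod C w) (Cod C w) [Bwd w, Fwd w] []"

definition zigzag_class ::
  "('o, 'm) cat \<Rightarrow> 'm set \<Rightarrow> 'o \<Rightarrow> 'o \<Rightarrow> 'm step list \<Rightarrow> 'm step list set" where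
  "zigzag_class C W x y us = {vs. zigzag_eq C W x y us vs}"

definition localization ::
  "('o, 'm) cat \<Rightarrow> 'm set \<Rightarrow> ('o, 'o \<times> 'm step list set \<times> 'o) cat" where
  "localization C W =
     \<lparr>Obj = Obj C,
      Arr = {(x, zigzag_class C W x y us, y) | x us y. zigzag C W x us y},
      Dom = (\<lambda>(x, A, y). x),
      Cod = (\<lambda>(x, A, y). y),
      Ident = (\<lambda>x. (x, zigzag_class C W x x [], x)),
      Comp = (\<lambda>(y', B, z) (x, A, y).
        (x, {ws. \<exists>us \<in> A. \<exists>vs \<in> B. zigzag_eq C W x z (us @ vs) ws}, z))\<rparr>"


section \<open>The poset [n] as a category\<close>

text \<open>The arrow from \<open>i\<close> to \<open>j\<close> is represented by the pair \<open>(i, j)\<close>.\<close>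

definition ordinal_cat :: "nat \<Rightarrow> (nat, nat \<times> nat) cat" where
  "ordinal_cat n =
     \<lparr>Obj = {0..n},
      Arr = {(i, j). i \<le> j \<and> j \<le> n},
      Dom = fst,
      Cod = snd,
      Ident = (\<lambda>i. (i, i)),
      Comp = (\<lambda>g f. (fst f, snd g))\<rparr>"


section \<open>Well-definedness\<close>

lemma category_ordinal_cat: "category (ordinal_cat n)"
  unfolding category_def ordinal_cat_def Hom_def by auto

lemma has_finite_limits_ordinal_cat: "has_finite_limits (ordinal_cat n)"
  unfolding has_finite_limits_def
proof (intro allI impI, elim conjE)
  fix J :: "(nat, nat) cat" and Fo :: "nat \<Rightarrow> nat" and Fa
  assume J: "category J" and fin: "finite (Obj J)" and F: "is_functor J (ordinal_cat n) Fo Fa"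
  define x where "x = Min (insert n (Fo ` Obj J))"
  have x_le: "x \<le> Fo j" if "j \<in> Obj J" for j
    using that fin by (simp add: x_def)
  have x_n: "x \<le> n"
    using fin by (simp add: x_def)
  have Fo_n: "Fo j \<le> n" if "j \<in> Obj J" for j
    using F that by (auto simp: is_functor_def ordinal_cat_def)
  have Fa_eq: "Fa a = (Fo (Dom J a), Fo (Cod J a))" if "a \<in> Arr J" for a
    using F that by (auto simp: is_functor_def ordinal_cat_def Hom_def prod_eq_iff)
  have endpoints: "Dom J a \<in> Obj J" "Cod J a \<in> Obj J" if "a \<in> Arr J" for a
    using J that by (auto simp: category_def)
  have "is_limit J (ordinal_cat n) Fo Fa x (\<lambda>j. (x, Fo j))"
    unfolding is_limit_def
  proof (intro conjI allI impI)
    show "is_cone J (ordinal_cat n) Fo Fa x (\<lambda>j. (x, Fo j))"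
      using x_le x_n Fo_n Fa_eq endpoints
      by (auto simp: is_cone_def ordinal_cat_def Hom_def)
  next
    fix y \<psi> assume cone: "is_cone J (ordinal_cat n) Fo Fa y \<psi>"
    have y: "y \<le> n" "\<And>j. j \<in> Obj J \<Longrightarrow> \<psi> j = (y, Fo j) \<and> y \<le> Fo j"
      using cone by (auto simp: is_cone_def ordinal_cat_def Hom_def prod_eq_iff)
    have "y \<le> x"
      using y fin by (auto simp: x_def)
    then show "\<exists>!u. u \<in> Hom (ordinal_cat n) y x \<and>
        (\<forall>j\<in>Obj J. Comp (ordinal_cat n) (x, Fo j) u = \<psi> j)"
      using y x_n by (intro ex1I[of _ "(y, x)"]) (auto simp: ordinal_cat_def Hom_def)
  qed
  then show "\<exists>x \<phi>. is_limit J (ordinal_cat n) Fo Fa x \<phi>" by blast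
qed

lemma has_finite_colimits_ordinal_cat: "has_finite_colimits (ordinal_cat n)"
  unfolding has_finite_colimits_def has_finite_limits_def
proof (intro allI impI, elim conjE)
  let ?C = "opposite (ordinal_cat n)"
  fix J :: "(nat, nat) cat" and Fo :: "nat \<Rightarrow> nat" and Fa
  assume J: "category J" and fin: "finite (Obj J)" and F: "is_functor J ?C Fo Fa"
  define x where "x = Max (insert 0 (Fo ` Obj J))"
  have x_ge: "Fo j \<le> x" if "j \<in> Obj J" for j
    using that fin by (simp add: x_def)
  have Fo_n: "Fo j \<le> n" if "j \<in> Obj J" for j
    using F that by (auto simp: is_functor_def ordinal_cat_def opposite_def)
  have x_n: "x \<le> n"
    using fin Fo_n by (auto simp: x_def)
  have Fa_eq: "Fa a = (Fo (Cod J a), Fo (Dom J a))" if "a \<in> Arr J" for a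
    using F that by (auto simp: is_functor_def ordinal_cat_def opposite_def Hom_def prod_eq_iff)
  have endpoints: "Dom J a \<in> Obj J" "Cod J a \<in> Obj J" if "a \<in> Arr J" for a
    using J that by (auto simp: category_def)
  have "is_limit J ?C Fo Fa x (\<lambda>j. (Fo j, x))"
    unfolding is_limit_def
  proof (intro conjI allI impI)
    show "is_cone J ?C Fo Fa x (\<lambda>j. (Fo j, x))"
      using x_ge x_n Fo_n Fa_eq endpoints
      by (auto simp: is_cone_def ordinal_cat_def opposite_def Hom_def)
  next
    fix y \<psi> assume cone: "is_cone J ?C Fo Fa y \<psi>"
    have y: "y \<le> n" "\<And>j. j \<in> Obj J \<Longrightarrow> \<psi> j = (Fo j, y) \<and> Fo j \<le> y"
      using cone by (auto simp: is_cone_def ordinal_cat_def opposite_def Hom_def prod_eq_iff)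
    have "x \<le> y"
      using y fin by (auto simp: x_def)
    then show "\<exists>!u. u \<in> Hom ?C y x \<and> (\<forall>j\<in>Obj J. Comp ?C (Fo j, x) u = \<psi> j)"
      using y x_n
      by (intro ex1I[of _ "(x, y)"]) (auto simp: ordinal_cat_def opposite_def Hom_def)
  qed
  then show "\<exists>x \<phi>. is_limit J ?C Fo Fa x \<phi>" by blast
qed

lemma zigzag_append:
  "zigzag C W x us y \<Longrightarrow> zigzag C W y vs z \<Longrightarrow> zigzag C W x (us @ vs) z"
proof (induction rule: zigzag.induct)
  case (zigzag_Nil x)
  then show ?case by simp
next
  case (zigzag_Fwd f us y)
  then show ?case by (metis append_Cons zigzag.zigzag_Fwd)
next
  case (zigzag_Bwd w us y)
  then show ?case by (metis append_Cons zigzag.zigzag_Bwd)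
qed

lemma zigzag_endpoints:
  assumes "category C" "W \<subseteq> Arr C" "zigzag C W x us y"
  shows "x \<in> Obj C" "y \<in> Obj C"
  using assms(3,1,2) by (induction rule: zigzag.induct) (auto simp: category_def)

lemma zigzag_eq_zigzag:
  assumes C: "category C" and W: "W \<subseteq> Arr C" and "zigzag_eq C W x y us vs"
  shows "zigzag C W x us y \<and> zigzag C W x vs y"
  using assms(3)
proof (induction rule: zigzag_eq.induct)
  case (zeq_append x y us us' z vs vs')
  then show ?case by (auto intro: zigzag_append)
next
  case (zeq_Ident x)
  then have "Ident C x \<in> Hom C x x" using C by (simp add: category_def)
  then show ?case
    using zeq_Ident zigzag_Fwd[of "Ident C x" C W "[]" x]
    by (auto simp: Hom_def intro: zigzag_Nil)
next
  case (zeq_Comp f g)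
  have obj: "Cod C g \<in> Obj C" using C zeq_Comp by (simp add: category_def)
  have "Comp C g f \<in> Hom C (Dom C f) (Cod C g)"
    using C zeq_Comp unfolding category_def Hom_def by blast
  then have "zigzag C W (Dom C f) [Fwd (Comp C g f)] (Cod C g)"
    using zigzag_Fwd[of "Comp C g f" C W "[]" "Cod C g"] obj
    by (auto simp: Hom_def intro: zigzag_Nil)
  then show ?case
    using zeq_Comp obj zigzag_Fwd[of f C W "[Fwd g]" "Cod C g"]
    by (auto intro: zigzag.intros)
next
  case (zeq_Fwd_Bwd w)
  then have "w \<in> Arr C" "Dom C w \<in> Obj C" using C W by (auto simp: category_def)
  then show ?case using zeq_Fwd_Bwd by (auto intro!: zigzag.intros)
next
  case (zeq_Bwd_Fwd w)
  then have "w \<in> Arr C" "Cod C w \<in> Obj C" using C W by (auto simp: category_def)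
  then show ?case using zeq_Bwd_Fwd by (auto intro!: zigzag.intros)
qed auto

lemma zigzag_class_eq_iff:
  assumes "zigzag C W x us y"
  shows "zigzag_class C W x y us = zigzag_class C W x y vs \<longleftrightarrow> zigzag_eq C W x y us vs"
proof
  assume "zigzag_class C W x y us = zigzag_class C W x y vs"
  then have "zigzag_eq C W x y vs us"
    using zeq_refl[OF assms] unfolding zigzag_class_def by blast
  then show "zigzag_eq C W x y us vs" by (rule zeq_sym)
next
  assume eq: "zigzag_eq C W x y us vs"
  have "zigzag_eq C W x y us ws \<longleftrightarrow> zigzag_eq C W x y vs ws" for ws
    using zeq_trans[OF eq] zeq_trans[OF zeq_sym[OF eq]] by (rule iffI[rotated])
  then show "zigzag_class C W x y us = zigzag_class C W x y vs"
    unfolding zigzag_class_def by (rule Collect_cong)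
qed

lemma Comp_localization:
  assumes "zigzag C W x us y" "zigzag C W y vs z"
  shows "Comp (localization C W) (y, zigzag_class C W y z vs, z) (x, zigzag_class C W x y us, y)
    = (x, zigzag_class C W x z (us @ vs), z)"
proof -
  have "(\<exists>us' \<in> zigzag_class C W x y us. \<exists>vs' \<in> zigzag_class C W y z vs.
           zigzag_eq C W x z (us' @ vs') ws) \<longleftrightarrow> zigzag_eq C W x z (us @ vs) ws" (is "?L \<longleftrightarrow> ?R") for ws
  proof
    assume ?L
    then obtain us' vs' where *: "zigzag_eq C W x y us us'" "zigzag_eq C W y z vs vs'"
      "zigzag_eq C W x z (us' @ vs') ws"
      unfolding zigzag_class_def by blast
    show ?R
      using zeq_trans[OF zeq_append[OF *(1,2)] *(3)] .
  next
    assume ?R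
    moreover have "us \<in> zigzag_class C W x y us" "vs \<in> zigzag_class C W y z vs"
      using assms by (simp_all add: zigzag_class_def zeq_refl)
    ultimately show ?L by blast
  qed
  then show ?thesis
    by (simp add: localization_def zigzag_class_def)
qed

lemma in_Hom_localization:
  "F \<in> Hom (localization C W) x y \<longleftrightarrow>
     (\<exists>us. zigzag C W x us y \<and> F = (x, zigzag_class C W x y us, y))"
  by (auto simp: Hom_def localization_def)

lemma category_localization:
  assumes "category C" "W \<subseteq> Arr C"
  shows "category (localization C W)"
proof -
  let ?L = "localization C W"
  have 1: "Dom ?L F \<in> Obj ?L \<and> Cod ?L F \<in> Obj ?L" if "F \<in> Arr ?L" for F
    using that by (auto simp: localization_def dest: zigzag_endpoints[OF assms])
  have 2: "Ident ?L x \<in> Hom ?L x x" if "x \<in> Obj ?L" for x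
    unfolding in_Hom_localization
    by (rule exI[of _ "[]"]) (use that in \<open>simp add: localization_def zigzag_Nil\<close>)
  have 3: "Comp ?L G F \<in> Hom ?L x z"
    if F: "F \<in> Hom ?L x y" and G: "G \<in> Hom ?L y z" for x y z F G
  proof -
    obtain us where us: "zigzag C W x us y" "F = (x, zigzag_class C W x y us, y)"
      using F unfolding in_Hom_localization by blast
    obtain vs where vs: "zigzag C W y vs z" "G = (y, zigzag_class C W y z vs, z)"
      using G unfolding in_Hom_localization by blast
    show ?thesis
      unfolding in_Hom_localization using us vs
      by (intro exI[of _ "us @ vs"]) (simp add: Comp_localization zigzag_append)
  qed
  have 4: "Comp ?L F (Ident ?L x) = F \<and> Comp ?L (Ident ?L y) F = F"
    if F: "F \<in> Hom ?L x y" for x y F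
  proof -
    obtain us where us: "zigzag C W x us y" "F = (x, zigzag_class C W x y us, y)"
      using F unfolding in_Hom_localization by blast
    have "zigzag C W x [] x" "zigzag C W y [] y"
      using zigzag_endpoints[OF assms us(1)] by (auto intro: zigzag_Nil)
    moreover have "Ident ?L x = (x, zigzag_class C W x x [], x)" for x
      by (simp add: localization_def)
    ultimately show ?thesis using us by (simp add: Comp_localization)
  qed
  have 5: "Comp ?L H (Comp ?L G F) = Comp ?L (Comp ?L H G) F"
    if F: "F \<in> Hom ?L w x" and G: "G \<in> Hom ?L x y" and H: "H \<in> Hom ?L y z" for w x y z F G H
  proof -
    obtain us where us: "zigzag C W w us x" "F = (w, zigzag_class C W w x us, x)"
      using F unfolding in_Hom_localization by blast
    obtain vs where vs: "zigzag C W x vs y" "G = (x, zigzag_class C W x y vs, y)"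
      using G unfolding in_Hom_localization by blast
    obtain ws where ws: "zigzag C W y ws z" "H = (y, zigzag_class C W y z ws, z)"
      using H unfolding in_Hom_localization by blast
    show ?thesis
      using us vs ws by (simp add: Comp_localization zigzag_append)
  qed
  show ?thesis
    unfolding category_def
    by (intro conjI) (rule ballI 1 2 allI impI 3 4 5 | assumption)+
qed

end

theory Submission
  imports Defs
begin

text \<open>Pushout closure of acyclic cofibrations and pullback closure of acyclic fibrations, with the
  2-out-of-3 property, force every arrow between the ends of a weak equivalence to be a weak
  equivalence. So \<open>W\<close> is the relation of lying in the same block for a partition of \<open>[n]\<close> into
  intervals, and the homotopy category is \<open>[k]\<close> for \<open>k + 1\<close> blocks. The acyclic fibrations \<open>T\<close> form
  a transfer system whose arrows stay within blocks; they determine the cofibrations, hence the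
  acyclic cofibrations, hence the fibrations, and conversely every such \<open>T\<close> arises.
  The pairs (partition, \<open>T\<close>) are counted by deleting the least point, which leads to
  \<open>x(m + 1, b) = x(m, b - 1) + 2 x(m, b) + x(m, b + 1)\<close> for \<open>m\<close> points and \<open>b\<close> blocks,
  a recursion solved by ballot numbers.\<close>

section \<open>Transfer systems within interval partitions\<close>

text \<open>In a poset the retract argument yields equalities, so each class of a weak factorization
  system is exactly the lifting class of the other; this is why \<open>T\<close> and the partition
  carry all the data. When the least point \<open>a\<close> goes, the only part of \<open>T\<close>
  lost is its row, an interval \<open>{a..<e}\<close>. By transitivity no remaining arrow crosses
  \<open>e\<close>, so \<open>e\<close> can be recorded as an extra block start of what is left.
  This changes the number of blocks, and so the induction must treat all block counts at once and
  not only \<open>k + 1\<close>. The weights 1, 2, 1 of the recursion are those of two half-unit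
  steps of a walk on the block count, and the walk is killed at 0 because a nonempty interval has at
  least one block. The reflection principle suggests the solution: for \<open>m + 1\<close> points
  and \<open>b\<close> blocks, the difference of \<open>2m + 1\<close> choose \<open>m + b\<close>
  and \<open>2m + 1\<close> choose \<open>m + 1 + b\<close> changes sign under
  \<open>b -> -b\<close>, hence vanishes at \<open>b = 0\<close>.\<close>

text \<open>On \<open>{a..n}\<close>, \<open>S\<close> is the set of least elements of the blocks and \<open>T\<close> is a transfer system. The
  pullback of \<open>(i, j)\<close> along \<open>(m, j)\<close> is \<open>(min i m, m)\<close>, an identity unless \<open>i < m\<close>.\<close>

definition blocked_transfer :: "nat \<Rightarrow> nat \<Rightarrow> nat set \<Rightarrow> (nat \<times> nat) set \<Rightarrow> bool" where
  "blocked_transfer n a S T \<longleftrightarrow> S \<subseteq> {a..n} \<and> (a \<le> n \<longrightarrow> a \<in> S) \<and>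
     (\<forall>i j. (i, j) \<in> T \<longrightarrow> a \<le> i \<and> i \<le> j \<and> j \<le> n) \<and>
     (\<forall>i. a \<le> i \<and> i \<le> n \<longrightarrow> (i, i) \<in> T) \<and>
     (\<forall>i j l. (i, j) \<in> T \<and> (j, l) \<in> T \<longrightarrow> (i, l) \<in> T) \<and>
     (\<forall>i m j. (i, j) \<in> T \<and> i \<le> m \<and> m \<le> j \<longrightarrow> (i, m) \<in> T) \<and>
     (\<forall>i j s. (i, j) \<in> T \<and> i < s \<and> s \<le> j \<longrightarrow> s \<notin> S)"

lemma blocked_transferD:
  assumes "blocked_transfer n a S T"
  shows "S \<subseteq> {a..n}" "a \<le> n \<Longrightarrow> a \<in> S"
    and "(i, j) \<in> T \<Longrightarrow> a \<le> i" "(i, j) \<in> T \<Longrightarrow> i \<le> j" "(i, j) \<in> T \<Longrightarrow> j \<le> n"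
    and "a \<le> i \<Longrightarrow> i \<le> n \<Longrightarrow> (i, i) \<in> T"
    and "(i, j) \<in> T \<Longrightarrow> (j, l) \<in> T \<Longrightarrow> (i, l) \<in> T"
    and "(i, j) \<in> T \<Longrightarrow> i \<le> m \<Longrightarrow> m \<le> j \<Longrightarrow> (i, m) \<in> T"
    and "(i, j) \<in> T \<Longrightarrow> i < s \<Longrightarrow> s \<le> j \<Longrightarrow> s \<notin> S"
  using assms unfolding blocked_transfer_def by blast+

definition blocked_transfers :: "nat \<Rightarrow> nat \<Rightarrow> nat \<Rightarrow> (nat set \<times> (nat \<times> nat) set) set" where
  "blocked_transfers n a b = {(S, T). blocked_transfer n a S T \<and> card S = b}"

lemma finite_blocked_transfers: "finite (blocked_transfers n a b)"
proof (rule finite_subset)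
  show "blocked_transfers n a b \<subseteq> Pow {a..n} \<times> Pow ({a..n} \<times> {a..n})"
  proof (clarsimp simp: blocked_transfers_def, intro conjI)
    fix S T assume v: "blocked_transfer n a S T"
    show "S \<subseteq> {a..n}" by (rule blocked_transferD(1)[OF v])
    show "T \<subseteq> {a..n} \<times> {a..n}"
      using blocked_transferD(3-5)[OF v] by (force dest: le_trans)
  qed
qed auto

section \<open>Removing and adjoining the least point\<close>

definition row_end :: "nat \<Rightarrow> (nat \<times> nat) set \<Rightarrow> nat" where
  "row_end a T = (LEAST s. a \<le> s \<and> (a, s) \<notin> T)"

lemma row_end_eq:
  assumes "a \<le> e" "\<And>m. (a, m) \<in> T \<longleftrightarrow> a \<le> m \<and> m < e"
  shows "row_end a T = e"
  unfolding row_end_def using assms by (intro Least_equality) (auto simp: not_less)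

text \<open>Pullback closure makes the row of \<open>a\<close> an initial segment of
  \<open>{a..n}\<close>. Its end is taken exclusive, so that it can be compared directly with the
  start of the next block, \<open>Suc n\<close> standing for the end of the last one.\<close>

lemma blocked_transfer_row_end:
  assumes v: "blocked_transfer n a S T" and "a \<le> n"
  shows "a < row_end a T" "row_end a T \<le> Suc n" "(a, m) \<in> T \<longleftrightarrow> a \<le> m \<and> m < row_end a T"
    and "T = {p \<in> T. a < fst p} \<union> {a} \<times> {a..<row_end a T}"
    and "S \<inter> {a<..<row_end a T} = {}"
proof -
  note D = blocked_transferD[OF v]
  define e where "e = row_end a T"
  \<comment> \<open>Targets of \<open>T\<close> are at most \<open>n\<close>, so
    \<open>Suc n\<close> witnesses that the least element defining \<open>row_end\<close>
    exists.\<close>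
  have "(a, Suc n) \<notin> T" using D(5)[of a "Suc n"] by auto
  then have e: "a \<le> e \<and> (a, e) \<notin> T" and "e \<le> Suc n"
    unfolding e_def row_end_def using LeastI[of "\<lambda>s. a \<le> s \<and> (a, s) \<notin> T" "Suc n"] \<open>a \<le> n\<close>
    by (auto intro: Least_le)
  have below: "(a, m) \<in> T" if "a \<le> m" "m < e" for m
    using that not_less_Least[of m] unfolding e_def row_end_def by blast
  have row: "(a, m) \<in> T \<longleftrightarrow> a \<le> m \<and> m < e" for m
  proof
    assume m: "(a, m) \<in> T"
    then show "a \<le> m \<and> m < e" using D(4)[OF m] D(8)[OF m, of e] e by (meson not_less)
  qed (use below in simp)
  have "a < e" using row[of a] D(6) \<open>a \<le> n\<close> by auto
  have "(i, m) \<in> T \<longleftrightarrow> (i, m) \<in> {p \<in> T. a < fst p} \<union> {a} \<times> {a..<e}" for i m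
    using D(3)[of i m] row[of m] by (cases "i = a") auto
  then have eq: "T = {p \<in> T. a < fst p} \<union> {a} \<times> {a..<e}"
    unfolding set_eq_iff split_paired_All by blast
  have "s \<notin> S" if "a < s" "s < e" for s
    using D(9)[of a s s] row[of s] that by simp
  then have "S \<inter> {a<..<e} = {}" by auto
  then show "a < row_end a T" "row_end a T \<le> Suc n" "(a, m) \<in> T \<longleftrightarrow> a \<le> m \<and> m < row_end a T"
      "T = {p \<in> T. a < fst p} \<union> {a} \<times> {a..<row_end a T}" "S \<inter> {a<..<row_end a T} = {}"
    using \<open>a < e\<close> \<open>e \<le> Suc n\<close> row eq unfolding e_def by blast+
qed

text \<open>A row ending at a block start of the tail composes harmlessly with \<open>T\<close>,
  since arrows of \<open>T\<close> stay within the blocks of \<open>S\<close>. Passing to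
  \<open>S0\<close> merges blocks, which keeps \<open>T\<close> valid; \<open>S0\<close> must miss
  \<open>{a<..<e}\<close> so that the new row lies within one block. The other three claims say that
  the extension can be undone.\<close>

lemma blocked_transfer_extend:
  assumes v: "blocked_transfer n (Suc a) S T" and "a < e" "e \<le> Suc n"
    and e: "e = Suc a \<or> e = Suc n \<or> e \<in> S" and S0: "S0 \<subseteq> S" "S0 \<inter> {a<..<e} = {}"
  shows "blocked_transfer n a (insert a S0) (T \<union> {a} \<times> {a..<e})"
    and "row_end a (T \<union> {a} \<times> {a..<e}) = e"
    and "{p \<in> T \<union> {a} \<times> {a..<e}. a < fst p} = T"
    and "insert a S0 - {a} = S0"
proof -
  note D = blocked_transferD[OF v]
  have "a \<le> n" using assms by simp
  \<comment> \<open>No arrow of \<open>T\<close> crosses \<open>e\<close>: there is no source below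
    \<open>Suc a\<close>, no target beyond \<open>n\<close>, and a block start blocks it otherwise.
    Only this makes the union transitive.\<close>
  have closed: "l < e" if "(i, l) \<in> T" "i < e" for i l
    using D(3,5,9)[OF that(1)] that e by (metis Suc_le_eq le_less_Suc_eq not_le not_less_eq)
  show "blocked_transfer n a (insert a S0) (T \<union> {a} \<times> {a..<e})"
    unfolding blocked_transfer_def
  proof (intro conjI allI impI; (elim conjE)?)
    show "insert a S0 \<subseteq> {a..n}" using D(1) S0 \<open>a \<le> n\<close> by fastforce
    show "a \<in> insert a S0" by simp
  next
    fix i l assume "(i, l) \<in> T \<union> {a} \<times> {a..<e}"
    then show "a \<le> i" "i \<le> l" "l \<le> n" using D(3-5)[of i l] \<open>e \<le> Suc n\<close> by auto
  next
    fix i assume "a \<le> i" "i \<le> n"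
    then show "(i, i) \<in> T \<union> {a} \<times> {a..<e}" using D(6)[of i] \<open>a < e\<close> by (cases "i = a") auto
  next
    fix i m l assume "(i, m) \<in> T \<union> {a} \<times> {a..<e}" "(m, l) \<in> T \<union> {a} \<times> {a..<e}"
    then show "(i, l) \<in> T \<union> {a} \<times> {a..<e}"
      using D(7)[of i m l] D(3,4)[of i m] D(3,4)[of m l] closed[of m l] by auto
  next
    fix i m l assume "(i, l) \<in> T \<union> {a} \<times> {a..<e}" "i \<le> m" "m \<le> l"
    then show "(i, m) \<in> T \<union> {a} \<times> {a..<e}" using D(8)[of i l m] by auto
  next
    fix i l s assume "(i, l) \<in> T \<union> {a} \<times> {a..<e}" "i < s" "s \<le> l"
    then show "s \<notin> insert a S0" using D(9)[of i l s] D(3)[of i l] S0 by auto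
  qed
  show "row_end a (T \<union> {a} \<times> {a..<e}) = e"
    using D(3)[of a] \<open>a < e\<close> by (intro row_end_eq) auto
  show "{p \<in> T \<union> {a} \<times> {a..<e}. a < fst p} = T"
    using D(3) by (auto simp: Suc_le_eq)
  show "insert a S0 - {a} = S0"
    using D(1) S0 by auto
qed

text \<open>The points \<open>Suc a\<close> and \<open>row_end a T\<close> become block starts: the
  first because it is now the least point, the second because no remaining arrow crosses it.
  Intersecting with \<open>{..n}\<close> discards the value \<open>Suc n\<close>.\<close>

lemma blocked_transfer_delete_least:
  assumes v: "blocked_transfer n a S T" and "a \<le> n"
  shows "blocked_transfer n (Suc a) ((S - {a} \<union> {Suc a, row_end a T}) \<inter> {..n}) {p \<in> T. a < fst p}"
proof -
  note D = blocked_transferD[OF v] and R = blocked_transfer_row_end[OF v \<open>a \<le> n\<close>]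
  \<comment> \<open>Composing \<open>(a, i)\<close> with \<open>(i, l)\<close> puts \<open>l\<close>
    into the row of \<open>a\<close>.\<close>
  have closed: "l < row_end a T" if "(i, l) \<in> T" "a < i" "i < row_end a T" for i l
    using D(7)[of a i l] R(3)[of i] R(3)[of l] that by auto
  show ?thesis
    unfolding blocked_transfer_def
  proof (intro conjI allI impI; (elim conjE)?)
    show "(S - {a} \<union> {Suc a, row_end a T}) \<inter> {..n} \<subseteq> {Suc a..n}"
      using D(1) R(1) by (auto simp: Suc_le_eq le_less)
  next
    fix i l assume "(i, l) \<in> {p \<in> T. a < fst p}"
    then show "Suc a \<le> i" "i \<le> l" "l \<le> n" using D(3-5)[of i l] by auto
  next
    fix i l s assume "(i, l) \<in> {p \<in> T. a < fst p}" "i < s" "s \<le> l"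
    then show "s \<notin> (S - {a} \<union> {Suc a, row_end a T}) \<inter> {..n}"
      using D(9)[of i l s] closed[of i l] by auto
  next
    fix i m l assume "(i, l) \<in> {p \<in> T. a < fst p}" "i \<le> m" "m \<le> l"
    then show "(i, m) \<in> {p \<in> T. a < fst p}" using D(8)[of i l m] by auto
  next
    fix i m l assume "(i, m) \<in> {p \<in> T. a < fst p}" "(m, l) \<in> {p \<in> T. a < fst p}"
    then show "(i, l) \<in> {p \<in> T. a < fst p}" using D(7)[of i m l] by auto
  qed (use D(6) in auto)
qed

text \<open>For a partition of \<open>{Suc a..n}\<close> this is the exclusive end of its first
  block; the value \<open>Suc n\<close> is the default when there is no second block.\<close>

definition next_start :: "nat \<Rightarrow> nat \<Rightarrow> nat set \<Rightarrow> nat" where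
  "next_start n a S = (LEAST s. Suc a < s \<and> (s \<in> S \<or> s = Suc n))"

lemma next_start_eq:
  assumes "Suc a < e" "e \<le> Suc n" "e \<in> S \<or> e = Suc n" "S \<inter> {Suc a<..<e} = {}"
  shows "next_start n a S = e"
  unfolding next_start_def using assms by (intro Least_equality) (auto simp: not_less[symmetric])

lemma next_start:
  assumes "a < n"
  shows "Suc a < next_start n a S" "next_start n a S \<le> Suc n"
    and "next_start n a S \<in> S \<or> next_start n a S = Suc n" "S \<inter> {Suc a<..<next_start n a S} = {}"
proof -
  let ?P = "\<lambda>s. Suc a < s \<and> (s \<in> S \<or> s = Suc n)"
  have P: "?P (Suc n)" using assms by simp
  show "Suc a < next_start n a S" "next_start n a S \<in> S \<or> next_start n a S = Suc n"
    using LeastI[of ?P, OF P] unfolding next_start_def by blast+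
  show "next_start n a S \<le> Suc n" using Least_le[of ?P, OF P] unfolding next_start_def .
  show "S \<inter> {Suc a<..<next_start n a S} = {}"
  proof -
    have "s \<notin> S" if "Suc a < s" "s < next_start n a S" for s
      using not_less_Least[of s ?P] that unfolding next_start_def by blast
    then show ?thesis by auto
  qed
qed

lemma blocked_transfers_delete:
  assumes "(S, T) \<in> blocked_transfers n a b" "a \<le> n"
    and S': "S' = (S - {a} \<union> {Suc a, row_end a T}) \<inter> {..n}" and "card S' = b'"
  shows "(S', {p \<in> T. a < fst p}) \<in> blocked_transfers n (Suc a) b'"
proof -
  have "blocked_transfer n a S T" using assms(1) by (simp add: blocked_transfers_def)
  from blocked_transfer_delete_least[OF this \<open>a \<le> n\<close>] show ?thesis
    using S' \<open>card S' = b'\<close> by (simp add: blocked_transfers_def)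
qed

lemma blocked_transfers_extend:
  assumes "(S, T) \<in> blocked_transfers n (Suc a) b'" "a < e" "e \<le> Suc n"
    and "e = Suc a \<or> e = Suc n \<or> e \<in> S" "S0 \<subseteq> S" "S0 \<inter> {a<..<e} = {}" "Suc (card S0) = b"
  shows "(insert a S0, T \<union> {a} \<times> {a..<e}) \<in> blocked_transfers n a b"
proof -
  have v: "blocked_transfer n (Suc a) S T" using assms(1) by (simp add: blocked_transfers_def)
  have "finite S" using blocked_transferD(1)[OF v] finite_subset by blast
  moreover have "a \<notin> S" using blocked_transferD(1)[OF v] by auto
  ultimately have "card (insert a S0) = b"
    using assms(5,7) finite_subset by (subst card_insert_disjoint) auto
  then show ?thesis
    using blocked_transfer_extend(1)[OF v assms(2-6)] by (simp add: blocked_transfers_def)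
qed

lemma blocked_transfers_cases:
  assumes "(S, T) \<in> blocked_transfers n a b" "a \<le> n"
  shows "S = insert a (S - {a})" "finite (S - {a})" "b = Suc (card (S - {a}))" "S - {a} \<subseteq> {Suc a..n}"
    and "a < row_end a T" "row_end a T \<le> Suc n"
    and "T = {p \<in> T. a < fst p} \<union> {a} \<times> {a..<row_end a T}" "S \<inter> {a<..<row_end a T} = {}"
proof -
  have v: "blocked_transfer n a S T" and b: "card S = b"
    using assms(1) by (auto simp: blocked_transfers_def)
  note D = blocked_transferD[OF v]
  have "finite S" using D(1) finite_subset by blast
  then show "finite (S - {a})" by simp
  show "S = insert a (S - {a})" using D(2) \<open>a \<le> n\<close> by auto
  show "b = Suc (card (S - {a}))" using card.remove[of S a] D(2) \<open>a \<le> n\<close> \<open>finite S\<close> b by simp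
  show "S - {a} \<subseteq> {Suc a..n}" using D(1) by fastforce
  show "a < row_end a T" "row_end a T \<le> Suc n"
      "T = {p \<in> T. a < fst p} \<union> {a} \<times> {a..<row_end a T}" "S \<inter> {a<..<row_end a T} = {}"
    by (fact blocked_transfer_row_end[OF v \<open>a \<le> n\<close>])+
qed

section \<open>Bijections behind the recursion\<close>

lemma card_eq_witness:
  assumes "\<And>x. x \<in> A \<Longrightarrow> f x \<in> B \<and> g (f x) = x" "\<And>y. y \<in> B \<Longrightarrow> g y \<in> A \<and> f (g y) = y"
  shows "card B = card A"
proof -
  have "bij_betw f A B"
    using assms by (intro bij_betw_byWitness[where f' = g]) blast+
  then show ?thesis by (rule bij_betw_same_card[symmetric])
qed

text \<open>Deleting the least point \<open>a\<close>: either \<open>a\<close> is a block of its own, or its row is trivial, or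
  its row is the whole block of \<open>a\<close>, or the end of its row splits the rest of the block in two.\<close>

lemma card_singleton_block:
  assumes "a \<le> n" "b \<ge> 1"
  shows "card {(S, T) \<in> blocked_transfers n a b. a = n \<or> Suc a \<in> S} =
         card (blocked_transfers n (Suc a) (b - 1))"
proof -
  define f where "f = (\<lambda>(S, T). (insert a S, T \<union> {a} \<times> {a..<Suc a}))"
  define g where "g = (\<lambda>(S :: nat set, T :: (nat \<times> nat) set). (S - {a}, {p \<in> T. a < fst p}))"
  let ?A = "blocked_transfers n (Suc a) (b - 1)"
  let ?B = "{(S, T) \<in> blocked_transfers n a b. a = n \<or> Suc a \<in> S}"
  have "f x \<in> ?B \<and> g (f x) = x" if "x \<in> ?A" for x
  proof -
    obtain S T where x: "x = (S, T)" by force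
    have ST: "(S, T) \<in> ?A" using that x by simp
    then have v: "blocked_transfer n (Suc a) S T" and "Suc (card S) = b"
      using \<open>b \<ge> 1\<close> by (auto simp: blocked_transfers_def)
    then have "a = n \<or> Suc a \<in> S" using blocked_transferD(2)[OF v] \<open>a \<le> n\<close> by linarith
    moreover have "(insert a S, T \<union> {a} \<times> {a..<Suc a}) \<in> blocked_transfers n a b"
      by (rule blocked_transfers_extend[OF ST]) (use \<open>a \<le> n\<close> \<open>Suc (card S) = b\<close> in auto)
    moreover have "S \<inter> {a<..<Suc a} = {}" by auto
    then have "{p \<in> T \<union> {a} \<times> {a..<Suc a}. a < fst p} = T" "insert a S - {a} = S"
      using blocked_transfer_extend(3,4)[OF v, of "Suc a" S] \<open>a \<le> n\<close> by blast+
    ultimately show ?thesis by (auto simp: x f_def g_def)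
  qed
  moreover have "g x \<in> ?A \<and> f (g x) = x" if "x \<in> ?B" for x
  proof -
    obtain S T where x: "x = (S, T)" by force
    have ST: "(S, T) \<in> blocked_transfers n a b" and S: "a = n \<or> Suc a \<in> S" using that x by auto
    note C = blocked_transfers_cases[OF ST \<open>a \<le> n\<close>]
    \<comment> \<open>The row of \<open>a\<close> contains no block start after \<open>a\<close>, so
      it stops before \<open>Suc a\<close>.\<close>
    have e: "row_end a T = Suc a" using S C(5,6,8) by (cases "row_end a T = Suc a") auto
    have "S - {a} = (S - {a} \<union> {Suc a, row_end a T}) \<inter> {..n}"
      using C(4) S unfolding e by auto
    from blocked_transfers_delete[OF ST \<open>a \<le> n\<close> this, of "b - 1"] show ?thesis
      using C(1,3,7) unfolding e by (simp add: x f_def g_def)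
  qed
  ultimately show ?thesis by (rule card_eq_witness)
qed

text \<open>Joining \<open>a\<close> to the block of \<open>Suc a\<close> only erases the start
  \<open>Suc a\<close>. As that start is always present in the tail, erasing it loses no
  information.\<close>

lemma card_trivial_row:
  assumes "a \<le> n" "b \<ge> 1"
  shows "card {(S, T) \<in> blocked_transfers n a b. \<not> (a = n \<or> Suc a \<in> S) \<and> row_end a T = Suc a} =
         card (blocked_transfers n (Suc a) b)"
proof -
  define f where "f = (\<lambda>(S, T). (insert a (S - {Suc a}), T \<union> {a} \<times> {a..<Suc a}))"
  define g where "g = (\<lambda>(S :: nat set, T :: (nat \<times> nat) set). (insert (Suc a) (S - {a}), {p \<in> T. a < fst p}))"
  let ?A = "blocked_transfers n (Suc a) b"
  let ?B = "{(S, T) \<in> blocked_transfers n a b. \<not> (a = n \<or> Suc a \<in> S) \<and> row_end a T = Suc a}"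
  have "f x \<in> ?B \<and> g (f x) = x" if "x \<in> ?A" for x
  proof -
    obtain S T where x: "x = (S, T)" by force
    have ST: "(S, T) \<in> ?A" using that x by simp
    then have v: "blocked_transfer n (Suc a) S T" and b: "card S = b"
      by (auto simp: blocked_transfers_def)
    \<comment> \<open>For \<open>a = n\<close> the tail is empty and has no block, contrary to
      \<open>b \<ge> 1\<close>.\<close>
    have "a < n" using blocked_transferD(1)[OF v] b \<open>b \<ge> 1\<close> by (cases "a < n") auto
    then have "Suc a \<in> S" using blocked_transferD(2)[OF v] by simp
    moreover have "finite S" using blocked_transferD(1)[OF v] finite_subset by blast
    ultimately have "Suc (card (S - {Suc a})) = b" using card.remove[of S "Suc a"] b by simp
    then have "(insert a (S - {Suc a}), T \<union> {a} \<times> {a..<Suc a}) \<in> blocked_transfers n a b"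
      by (intro blocked_transfers_extend[OF ST]) (use \<open>a < n\<close> in auto)
    moreover have "(S - {Suc a}) \<inter> {a<..<Suc a} = {}" by auto
    then have "row_end a (T \<union> {a} \<times> {a..<Suc a}) = Suc a"
        "{p \<in> T \<union> {a} \<times> {a..<Suc a}. a < fst p} = T" "insert a (S - {Suc a}) - {a} = S - {Suc a}"
      using blocked_transfer_extend(2-4)[OF v, of "Suc a" "S - {Suc a}"] \<open>a < n\<close> by auto
    ultimately show ?thesis using \<open>a < n\<close> \<open>Suc a \<in> S\<close>
      by (simp add: x f_def g_def insert_absorb)
  qed
  moreover have "g x \<in> ?A \<and> f (g x) = x" if "x \<in> ?B" for x
  proof -
    obtain S T where x: "x = (S, T)" by force
    have ST: "(S, T) \<in> blocked_transfers n a b" and S: "a < n" "Suc a \<notin> S"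
      and e: "row_end a T = Suc a" using that x \<open>a \<le> n\<close> by auto
    note C = blocked_transfers_cases[OF ST \<open>a \<le> n\<close>]
    have "insert (Suc a) (S - {a}) = (S - {a} \<union> {Suc a, row_end a T}) \<inter> {..n}"
      using C(4) S unfolding e by auto
    moreover have "card (insert (Suc a) (S - {a})) = b" using C(2,3) S by simp
    ultimately have "(insert (Suc a) (S - {a}), {p \<in> T. a < fst p}) \<in> ?A"
      using blocked_transfers_delete[OF ST \<open>a \<le> n\<close>] by blast
    moreover have "insert (Suc a) (S - {a}) - {Suc a} = S - {a}" using S by auto
    ultimately show ?thesis
      using C(1,7) unfolding e by (simp add: x f_def g_def)
  qed
  ultimately show ?thesis by (rule card_eq_witness)
qed

text \<open>Joining \<open>a\<close> to the first block of the tail, with a row through the whole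
  block, is again determined by the tail. The new row ends at \<open>next_start\<close>.\<close>

lemma card_full_row:
  assumes "a \<le> n" "b \<ge> 1"
  shows "card {(S, T) \<in> blocked_transfers n a b. \<not> (a = n \<or> Suc a \<in> S) \<and> row_end a T \<noteq> Suc a \<and>
           (row_end a T \<in> S \<or> row_end a T = Suc n)} =
         card (blocked_transfers n (Suc a) b)"
proof -
  define f where "f = (\<lambda>(S, T). (insert a (S - {Suc a}), T \<union> {a} \<times> {a..<next_start n a S}))"
  define g where "g = (\<lambda>(S :: nat set, T :: (nat \<times> nat) set). (insert (Suc a) (S - {a}), {p \<in> T. a < fst p}))"
  let ?A = "blocked_transfers n (Suc a) b"
  let ?B = "{(S, T) \<in> blocked_transfers n a b. \<not> (a = n \<or> Suc a \<in> S) \<and> row_end a T \<noteq> Suc a \<and>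
           (row_end a T \<in> S \<or> row_end a T = Suc n)}"
  have "f x \<in> ?B \<and> g (f x) = x" if "x \<in> ?A" for x
  proof -
    obtain S T where x: "x = (S, T)" by force
    have ST: "(S, T) \<in> ?A" using that x by simp
    then have v: "blocked_transfer n (Suc a) S T" and b: "card S = b"
      by (auto simp: blocked_transfers_def)
    have "a < n" using blocked_transferD(1)[OF v] b \<open>b \<ge> 1\<close> by (cases "a < n") auto
    note N = next_start[OF this, of S]
    have "Suc a \<in> S" using blocked_transferD(2)[OF v] \<open>a < n\<close> by simp
    moreover have "finite S" using blocked_transferD(1)[OF v] finite_subset by blast
    ultimately have card: "Suc (card (S - {Suc a})) = b" using card.remove[of S "Suc a"] b by simp
    have gap: "(S - {Suc a}) \<inter> {a<..<next_start n a S} = {}" using N(4) by fastforce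
    have "(insert a (S - {Suc a}), T \<union> {a} \<times> {a..<next_start n a S}) \<in> blocked_transfers n a b"
      by (intro blocked_transfers_extend[OF ST]) (use N gap card in auto)
    moreover note blocked_transfer_extend(2-4)[OF v, of "next_start n a S" "S - {Suc a}"]
    ultimately show ?thesis using \<open>a < n\<close> \<open>Suc a \<in> S\<close> N gap by (auto simp: x f_def g_def)
  qed
  moreover have "g x \<in> ?A \<and> f (g x) = x" if "x \<in> ?B" for x
  proof -
    obtain S T where x: "x = (S, T)" by force
    have ST: "(S, T) \<in> blocked_transfers n a b" and S: "a < n" "Suc a \<notin> S"
      and e: "row_end a T \<noteq> Suc a" "row_end a T \<in> S \<or> row_end a T = Suc n" using that x \<open>a \<le> n\<close> by auto
    note C = blocked_transfers_cases[OF ST \<open>a \<le> n\<close>]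
    have "insert (Suc a) (S - {a}) = (S - {a} \<union> {Suc a, row_end a T}) \<inter> {..n}"
      using C(4,5) S e by auto
    moreover have "card (insert (Suc a) (S - {a})) = b" using C(2,3) S by simp
    ultimately have "(insert (Suc a) (S - {a}), {p \<in> T. a < fst p}) \<in> ?A"
      using blocked_transfers_delete[OF ST \<open>a \<le> n\<close>] by blast
    moreover have "insert (Suc a) (S - {a}) - {Suc a} = S - {a}" using S by auto
    moreover have "next_start n a (insert (Suc a) (S - {a})) = row_end a T"
      using C(5,6,8) e by (intro next_start_eq) auto
    ultimately show ?thesis
      using C(1,7) by (simp add: x f_def g_def)
  qed
  ultimately show ?thesis by (rule card_eq_witness)
qed

text \<open>The first two blocks of the tail are merged with \<open>a\<close> into a single block.
  The start erased between them survives as the end of the row of \<open>a\<close>, which is how it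
  is recovered.\<close>

lemma card_proper_row:
  assumes "a \<le> n" "b \<ge> 1"
  shows "card {(S, T) \<in> blocked_transfers n a b. \<not> (a = n \<or> Suc a \<in> S) \<and> row_end a T \<noteq> Suc a \<and>
           \<not> (row_end a T \<in> S \<or> row_end a T = Suc n)} =
         card (blocked_transfers n (Suc a) (Suc b))"
proof -
  define f where "f = (\<lambda>(S, T).
    (insert a (S - {Suc a, next_start n a S}), T \<union> {a} \<times> {a..<next_start n a S}))"
  define g where "g = (\<lambda>(S :: nat set, T :: (nat \<times> nat) set).
    (S - {a} \<union> {Suc a, row_end a T}, {p \<in> T. a < fst p}))"
  let ?A = "blocked_transfers n (Suc a) (Suc b)"
  let ?B = "{(S, T) \<in> blocked_transfers n a b. \<not> (a = n \<or> Suc a \<in> S) \<and> row_end a T \<noteq> Suc a \<and>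
           \<not> (row_end a T \<in> S \<or> row_end a T = Suc n)}"
  have "f x \<in> ?B \<and> g (f x) = x" if "x \<in> ?A" for x
  proof -
    obtain S T where x: "x = (S, T)" by force
    have ST: "(S, T) \<in> ?A" using that x by simp
    then have v: "blocked_transfer n (Suc a) S T" and b: "card S = Suc b"
      by (auto simp: blocked_transfers_def)
    note D = blocked_transferD[OF v]
    have "a < n" using D(1) b by (cases "a < n") auto
    note N = next_start[OF this, of S]
    let ?e = "next_start n a S"
    have "Suc a \<in> S" using D(2) \<open>a < n\<close> by simp
    have "finite S" using D(1) finite_subset by blast
    \<comment> \<open>At least two blocks are present, so a start after \<open>Suc a\<close> exists
      and \<open>next_start\<close> does not take its default value.\<close>
    have "?e \<in> S"
    proof (rule ccontr)
      assume "?e \<notin> S"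
      then have "S \<inter> {Suc a<..n} = {}" using N(3,4) by auto
      then have "S \<subseteq> {Suc a}" using D(1) by fastforce
      then show False using b \<open>b \<ge> 1\<close> card_mono[of "{Suc a}" S] by simp
    qed
    then have "?e \<noteq> Suc n" using D(1) by auto
    have card: "Suc (card (S - {Suc a, ?e})) = b"
      using card_Diff_subset[of "{Suc a, ?e}" S] \<open>finite S\<close> \<open>Suc a \<in> S\<close> \<open>?e \<in> S\<close> N(1) b \<open>b \<ge> 1\<close>
      by simp
    have gap: "(S - {Suc a, ?e}) \<inter> {a<..<?e} = {}" using N(4) by fastforce
    have "(insert a (S - {Suc a, ?e}), T \<union> {a} \<times> {a..<?e}) \<in> blocked_transfers n a b"
      by (intro blocked_transfers_extend[OF ST]) (use N gap card in auto)
    moreover note blocked_transfer_extend(2-4)[OF v, of ?e "S - {Suc a, ?e}"]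
    ultimately show ?thesis
      using \<open>a < n\<close> \<open>Suc a \<in> S\<close> N gap \<open>?e \<in> S\<close> \<open>?e \<noteq> Suc n\<close> by (auto simp: x f_def g_def)
  qed
  moreover have "g x \<in> ?A \<and> f (g x) = x" if "x \<in> ?B" for x
  proof -
    obtain S T where x: "x = (S, T)" by force
    have ST: "(S, T) \<in> blocked_transfers n a b" and S: "a < n" "Suc a \<notin> S"
      and e: "row_end a T \<noteq> Suc a" "row_end a T \<notin> S" "row_end a T \<noteq> Suc n" using that x \<open>a \<le> n\<close> by auto
    note C = blocked_transfers_cases[OF ST \<open>a \<le> n\<close>]
    let ?S = "S - {a} \<union> {Suc a, row_end a T}"
    have "?S = ?S \<inter> {..n}" using C(4,6) S e by auto
    moreover have "card ?S = Suc b" using C(2,3) S e by simp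
    ultimately have "(?S, {p \<in> T. a < fst p}) \<in> ?A"
      using blocked_transfers_delete[OF ST \<open>a \<le> n\<close>] by blast
    moreover have "next_start n a ?S = row_end a T"
      using C(5,6,8) e by (intro next_start_eq) auto
    moreover have "?S - {Suc a, row_end a T} = S - {a}" using S e by auto
    ultimately show ?thesis
      using C(1,7) by (simp add: x f_def g_def)
  qed
  ultimately show ?thesis by (rule card_eq_witness)
qed

lemma card_blocked_transfers_rec:
  assumes "a \<le> n" "b \<ge> 1"
  shows "card (blocked_transfers n a b) = card (blocked_transfers n (Suc a) (b - 1)) +
    2 * card (blocked_transfers n (Suc a) b) + card (blocked_transfers n (Suc a) (Suc b))"
proof -
  have split: "card {x \<in> X. P x} = card {x \<in> X. P x \<and> Q x} + card {x \<in> X. P x \<and> \<not> Q x}"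
    if "finite X" for X :: "(nat set \<times> (nat \<times> nat) set) set" and P Q
    using that by (subst card_Un_disjoint[symmetric]) (auto intro!: arg_cong[of _ _ card])
  note F = finite_blocked_transfers[of n a b]
  let ?P = "\<lambda>(S, T :: (nat \<times> nat) set). a = n \<or> Suc a \<in> S"
  let ?Q = "\<lambda>(S :: nat set, T). row_end a T = Suc a"
  let ?R = "\<lambda>(S, T). row_end a T \<in> S \<or> row_end a T = Suc n"
  let ?X = "blocked_transfers n a b"
  have "card ?X = card {x \<in> ?X. ?P x} + (card {x \<in> ?X. \<not> ?P x \<and> ?Q x} +
     (card {x \<in> ?X. (\<not> ?P x \<and> \<not> ?Q x) \<and> ?R x} + card {x \<in> ?X. (\<not> ?P x \<and> \<not> ?Q x) \<and> \<not> ?R x}))"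
    using split[OF F, of "\<lambda>_. True" ?P] split[OF F, of "\<lambda>x. \<not> ?P x" ?Q]
      split[OF F, of "\<lambda>x. \<not> ?P x \<and> \<not> ?Q x" ?R] by simp
  then show ?thesis
    using card_singleton_block[OF assms] card_trivial_row[OF assms] card_full_row[OF assms]
      card_proper_row[OF assms]
    by (simp add: case_prod_unfold conj_assoc)
qed

lemma card_blocked_transfers_zero:
  assumes "a \<le> n"
  shows "card (blocked_transfers n a 0) = 0"
proof -
  have False if "(S, T) \<in> blocked_transfers n a 0" for S T
    using blocked_transfers_cases(3)[OF that assms] by simp
  then have "blocked_transfers n a 0 = {}" by auto
  then show ?thesis by simp
qed

lemma blocked_transfers_empty: "blocked_transfers n (Suc n) b = (if b = 0 then {({}, {})} else {})"
proof -
  have "blocked_transfer n (Suc n) S T \<longleftrightarrow> S = {} \<and> T = {}" for S T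
  proof
    assume v: "blocked_transfer n (Suc n) S T"
    have "(i, j) \<notin> T" for i j using blocked_transferD(3-5)[OF v, of i j] by auto
    then show "S = {} \<and> T = {}" using blocked_transferD(1)[OF v] by auto
  qed (simp add: blocked_transfer_def)
  then show ?thesis by (auto simp: blocked_transfers_def)
qed

section \<open>Solution by binomial coefficients\<close>

lemma choose_add_two:
  "(n + 2) choose (j + 2) = (n choose (j + 2)) + 2 * (n choose (j + 1)) + (n choose j)"
proof -
  have "Suc (Suc n) choose Suc (Suc j) =
      (n choose Suc (Suc j)) + 2 * (n choose Suc j) + (n choose j)"
    by simp
  then show ?thesis by (simp del: binomial_Suc_Suc)
qed

text \<open>A difference of binomial coefficients, stated as a sum to avoid truncated subtraction.\<close>

lemma card_blocked_transfers_ballot: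
  assumes "m \<le> n"
  shows "card (blocked_transfers n (n - m) b) + ((2 * m + 1) choose (m + 1 + b)) =
    (2 * m + 1) choose (m + b)"
  using assms
proof (induction m arbitrary: b)
  case 0
  show ?case
  proof (cases b)
    case 0
    then show ?thesis using card_blocked_transfers_zero[of n n] by simp
  next
    case (Suc c)
    \<comment> \<open>One application of the recursion leads to the empty interval, where only zero
      blocks are possible; so only \<open>b = 1\<close> contributes.\<close>
    then show ?thesis
      using card_blocked_transfers_rec[of n n b] by (simp add: blocked_transfers_empty)
  qed
next
  case (Suc m)
  show ?case
  proof (cases b)
    case 0
    \<comment> \<open>The two binomials are the middle ones of an odd row, so they cancel, in
      agreement with the count 0.\<close>
    have "(2 * Suc m + 1) choose (Suc m + 1) = (2 * Suc m + 1) choose (Suc m)"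
      by (subst binomial_symmetric) auto
    then show ?thesis using card_blocked_transfers_zero[of "n - Suc m" n] 0 by simp
  next
    case (Suc c)
    have *: "Suc (n - Suc m) = n - m" using Suc.prems by simp
    define N where "N = (\<lambda>b. card (blocked_transfers n (n - m) b))"
    define B where "B = (\<lambda>j. (2 * m + 1) choose j)"
    have IH: "N b + B (m + 1 + b) = B (m + b)" for b
      using Suc.IH[of b] Suc.prems unfolding N_def B_def by simp
    \<comment> \<open>Pascal's rule used twice gives the same weights 1, 2, 1 as the recursion, so
      the induction hypothesis can be added up termwise.\<close>
    have B2: "(2 * Suc m + 1) choose (j + 2) = B (j + 2) + 2 * B (j + 1) + B j" for j
      using choose_add_two[of "2 * m + 1" j] unfolding B_def by simp
    have rec: "card (blocked_transfers n (n - Suc m) b) = N c + 2 * N (c + 1) + N (c + 2)"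
      using card_blocked_transfers_rec[of "n - Suc m" n b] Suc unfolding * N_def by simp
    have i: "Suc m + 1 + b = (m + c + 1) + 2" "Suc m + b = (m + c) + 2" using Suc by simp_all
    have "N c + B (m + c + 1) = B (m + c)" "N (c + 1) + B (m + c + 1 + 1) = B (m + c + 1)"
        "N (c + 2) + B (m + c + 1 + 2) = B (m + c + 2)"
      using IH[of c] IH[of "c + 1"] IH[of "c + 2"] by simp_all
    moreover have "B (m + c + 1 + 1) = B (m + c + 2)" by simp
    ultimately show ?thesis unfolding i B2 rec by linarith
  qed
qed

lemma card_blocked_transfers:
  assumes "k \<le> n"
  shows "real (card (blocked_transfers n 0 (Suc k))) =
    2 * (real k + 1) / (real n + real k + 2) * real ((2 * n + 1) choose (n - k))"
proof -
  define B where "B = (2 * n + 1) choose (n + k + 1)"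
  define B' where "B' = (2 * n + 1) choose (n + k + 2)"
  have "(2 * n + 1) choose (n - k) = B"
    unfolding B_def using assms by (subst binomial_symmetric) auto
  \<comment> \<open>The ratio of neighbouring binomials. It turns \<open>B - B'\<close> into
    \<open>B\<close> times \<open>1 - (n - k) / (n + k + 2)\<close>, which is the source of the
    factor \<open>2 (k + 1) / (n + k + 2)\<close>.\<close>
  have "(n + k + 2) * B' = (n - k) * B"
    using binomial_absorption[of "n + k + 1" "2 * n + 1"]
      binomial_absorb_comp[of "2 * n + 1" "n + k + 1"] assms
    unfolding B_def B'_def by simp
  then have "(real n + real k + 2) * real B' = (real n - real k) * real B"
    using assms by (metis of_nat_add of_nat_diff of_nat_mult of_nat_numeral)
  moreover have "card (blocked_transfers n 0 (Suc k)) + B' = B"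
    using card_blocked_transfers_ballot[of n n "Suc k"] unfolding B_def B'_def by simp
  then have card: "real (card (blocked_transfers n 0 (Suc k))) = real B - real B'" by linarith
  ultimately have "(real n + real k + 2) * real (card (blocked_transfers n 0 (Suc k))) =
      2 * (real k + 1) * real B"
    unfolding card by (simp add: algebra_simps)
  then show ?thesis
    unfolding \<open>(2 * n + 1) choose (n - k) = B\<close> by (simp add: field_simps)
qed

section \<open>The homotopy category\<close>

lemma Hom_ordinal_cat: "Hom (ordinal_cat n) i j = (if i \<le> j \<and> j \<le> n then {(i, j)} else {})"
  by (auto simp: Hom_def ordinal_cat_def)

lemma is_iso_ordinal_cat: "is_iso (ordinal_cat n) (i, i) \<longleftrightarrow> i \<le> n"
  by (auto simp: is_iso_def Hom_ordinal_cat) (auto simp: ordinal_cat_def)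

lemma is_isoE:
  assumes "is_iso C f" "f \<in> Hom C x y"
  obtains g where "g \<in> Hom C y x"
  using assms by (auto simp: is_iso_def Hom_def)

text \<open>An equivalence with \<open>[k]\<close> is used only through the preorder it induces on
  objects. Surjectivity on objects holds strictly, because isomorphic objects of \<open>[k]\<close>
  are equal.\<close>

lemma equivalent_ordinal_catE:
  assumes "equivalent_categories C (ordinal_cat k)"
  obtains F where "F ` Obj C = {0..k}"
    and "\<And>x y. x \<in> Obj C \<Longrightarrow> y \<in> Obj C \<Longrightarrow> Hom C x y \<noteq> {} \<longleftrightarrow> F x \<le> F y"
proof -
  obtain F Fa G Ga \<eta> \<epsilon> where C: "category C" and F: "is_functor C (ordinal_cat k) F Fa"
    and G: "is_functor (ordinal_cat k) C G Ga"
    and \<eta>: "natural_iso C C (G \<circ> F) (Ga \<circ> Fa) id id \<eta>"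
    and \<epsilon>: "natural_iso (ordinal_cat k) (ordinal_cat k) (F \<circ> G) (Fa \<circ> Ga) id id \<epsilon>"
    using assms unfolding equivalent_categories_def by blast
  have comp: "Hom C x z \<noteq> {}" if "Hom C x y \<noteq> {}" "Hom C y z \<noteq> {}" for x y z
    using C that unfolding category_def by blast
  have Fk: "F x \<le> k" if "x \<in> Obj C" for x
    using F that by (auto simp: is_functor_def ordinal_cat_def)
  have G_Obj: "G c \<in> Obj C" if "c \<le> k" for c
    using G that by (auto simp: is_functor_def ordinal_cat_def)
  have FG: "F (G c) = c" if "c \<le> k" for c
  proof -
    have "\<epsilon> c \<in> Hom (ordinal_cat k) (F (G c)) c" "is_iso (ordinal_cat k) (\<epsilon> c)"
      using \<epsilon> that by (auto simp: natural_iso_def ordinal_cat_def)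
    then obtain g where "g \<in> Hom (ordinal_cat k) c (F (G c))" by (metis is_isoE)
    then show ?thesis
      using \<open>\<epsilon> c \<in> _\<close> by (auto simp: Hom_ordinal_cat split: if_splits)
  qed
  show thesis
  proof
    show "F ` Obj C = {0..k}"
      using Fk FG G_Obj by (force simp: image_iff)
  next
    fix x y assume x: "x \<in> Obj C" and y: "y \<in> Obj C"
    show "Hom C x y \<noteq> {} \<longleftrightarrow> F x \<le> F y"
    proof
      assume "Hom C x y \<noteq> {}"
      then obtain f where "f \<in> Arr C" "Dom C f = x" "Cod C f = y" by (auto simp: Hom_def)
      then have "Fa f \<in> Hom (ordinal_cat k) (F x) (F y)"
        using F by (auto simp: is_functor_def)
      then show "F x \<le> F y" by (auto simp: Hom_ordinal_cat split: if_splits)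
    next
      \<comment> \<open>The arrow is transported back along \<open>G\<close> and conjugated by the
        components of \<open>\<eta>\<close>, the one at \<open>x\<close> being inverted.\<close>
      assume "F x \<le> F y"
      then have "(F x, F y) \<in> Arr (ordinal_cat k)" using Fk[OF y] by (simp add: ordinal_cat_def)
      moreover have "\<forall>f \<in> Arr (ordinal_cat k).
          Ga f \<in> Hom C (G (Dom (ordinal_cat k) f)) (G (Cod (ordinal_cat k) f))"
        using G unfolding is_functor_def by blast
      ultimately have "Ga (F x, F y) \<in> Hom C (G (Dom (ordinal_cat k) (F x, F y)))
          (G (Cod (ordinal_cat k) (F x, F y)))" by (rule bspec[rotated])
      then have "Ga (F x, F y) \<in> Hom C (G (F x)) (G (F y))"
        by (simp add: ordinal_cat_def)
      moreover have "\<eta> x \<in> Hom C (G (F x)) x" "is_iso C (\<eta> x)" "\<eta> y \<in> Hom C (G (F y)) y"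
        using \<eta> x y by (auto simp: natural_iso_def)
      moreover from this obtain g where "g \<in> Hom C x (G (F x))" by (metis is_isoE)
      ultimately show "Hom C x y \<noteq> {}" using comp by blast
    qed
  qed
qed

text \<open>Since parallel arrows are equal, arbitrary choices of arrows \<open>h\<close> and of a
  section \<open>r\<close> of \<open>q\<close> are automatically functorial and natural.\<close>

lemma thin_equivalent_ordinal_cat:
  assumes C: "category C"
    and thin: "\<And>x y f g. f \<in> Hom C x y \<Longrightarrow> g \<in> Hom C x y \<Longrightarrow> f = g"
    and q: "q ` Obj C = {0..k}"
    and Hom: "\<And>x y. x \<in> Obj C \<Longrightarrow> y \<in> Obj C \<Longrightarrow> Hom C x y \<noteq> {} \<longleftrightarrow> q x \<le> q y"
  shows "equivalent_categories C (ordinal_cat k)"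
proof -
  define h where "h = (\<lambda>x y. SOME f. f \<in> Hom C x y)"
  define r where "r = (\<lambda>c. SOME x. x \<in> Obj C \<and> q x = c)"
  have h: "h x y \<in> Hom C x y" if "x \<in> Obj C" "y \<in> Obj C" "q x \<le> q y" for x y
    using Hom[OF that(1,2)] that(3) some_in_eq unfolding h_def by blast
  have r: "r c \<in> Obj C" "q (r c) = c" if "c \<le> k" for c
  proof -
    have "c \<in> q ` Obj C" using that q by simp
    then have "\<exists>x. x \<in> Obj C \<and> q x = c" by blast
    from someI_ex[OF this] show "r c \<in> Obj C" "q (r c) = c" unfolding r_def by simp_all
  qed
  have q_le: "q x \<le> k" if "x \<in> Obj C" for x using that q by auto
  have ends: "Dom C f \<in> Obj C" "Cod C f \<in> Obj C" if "f \<in> Arr C" for f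
    using C that by (auto simp: category_def)
  have arr: "f \<in> Hom C (Dom C f) (Cod C f)" if "f \<in> Arr C" for f
    using that by (simp add: Hom_def)
  have mono: "q (Dom C f) \<le> q (Cod C f)" if "f \<in> Arr C" for f
    using Hom[OF ends[OF that]] arr[OF that] by blast
  have comp: "Comp C g f \<in> Hom C x z" if "f \<in> Hom C x y" "g \<in> Hom C y z" for f g x y z
    using C that unfolding category_def by blast
  have ident: "Ident C x \<in> Hom C x x" if "x \<in> Obj C" for x
    using C that unfolding category_def by blast
  have iso: "is_iso C (h x y)" if "x \<in> Obj C" "y \<in> Obj C" "q x = q y" for x y
  proof -
    have xy: "h x y \<in> Hom C x y" and yx: "h y x \<in> Hom C y x" using h that by simp_all
    then have "Comp C (h y x) (h x y) = Ident C x" "Comp C (h x y) (h y x) = Ident C y"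
      using thin comp ident that by blast+
    then show ?thesis using xy yx unfolding is_iso_def by (auto simp: Hom_def)
  qed
  let ?D = "ordinal_cat k"
  let ?Fa = "\<lambda>f. (q (Dom C f), q (Cod C f))" and ?Ga = "\<lambda>(i, j). h (r i) (r j)"
  have F: "is_functor C ?D q ?Fa"
    unfolding is_functor_def
  proof (intro conjI ballI impI)
    fix f g assume "f \<in> Arr C" "g \<in> Arr C" "Cod C f = Dom C g"
    then have "Comp C g f \<in> Hom C (Dom C f) (Cod C g)" using arr comp by metis
    then show "?Fa (Comp C g f) = Comp ?D (?Fa g) (?Fa f)"
      by (simp add: Hom_def ordinal_cat_def)
  next
    fix x assume "x \<in> Obj C"
    then show "?Fa (Ident C x) = Ident ?D (q x)"
      using ident by (simp add: Hom_def ordinal_cat_def)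
  qed (use q_le mono ends in \<open>auto simp: Hom_ordinal_cat\<close>, auto simp: ordinal_cat_def)
  have hr: "h (r i) (r j) \<in> Hom C (r i) (r j)" if "i \<le> j" "j \<le> k" for i j
    using h[of "r i" "r j"] r[of i] r[of j] that by simp
  have G: "is_functor ?D C r ?Ga"
    unfolding is_functor_def
  proof (intro conjI ballI impI)
    fix f g assume "f \<in> Arr ?D" "g \<in> Arr ?D" "Cod ?D f = Dom ?D g"
    then obtain i j l where fg: "f = (i, j)" "g = (j, l)" and le: "i \<le> j" "j \<le> l" "l \<le> k"
      by (auto simp: ordinal_cat_def)
    have "Comp C (h (r j) (r l)) (h (r i) (r j)) = h (r i) (r l)"
      by (rule thin[OF comp[OF hr hr] hr]) (use le in auto)
    then show "?Ga (Comp ?D g f) = Comp C (?Ga g) (?Ga f)"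
      by (simp add: fg ordinal_cat_def)
  next
    fix i assume "i \<in> Obj ?D"
    then have "i \<le> k" by (simp add: ordinal_cat_def)
    then have "h (r i) (r i) = Ident C (r i)" using thin hr ident r by blast
    then show "?Ga (Ident ?D i) = Ident C (r i)" by (simp add: ordinal_cat_def)
  qed (use r hr in \<open>auto simp: ordinal_cat_def\<close>)
  have "natural_iso C C (r \<circ> q) (?Ga \<circ> ?Fa) id id (\<lambda>x. h (r (q x)) x)"
    unfolding natural_iso_def
  proof (intro conjI ballI)
    fix x assume x: "x \<in> Obj C"
    show "h (r (q x)) x \<in> Hom C ((r \<circ> q) x) (id x)" "is_iso C (h (r (q x)) x)"
      using h[of "r (q x)" x] iso[of "r (q x)" x] r[OF q_le[OF x]] x by simp_all
  next
    fix f assume f: "f \<in> Arr C"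
    let ?x = "Dom C f" and ?y = "Cod C f"
    note e = ends[OF f] and rx = r[OF q_le[OF ends(1)[OF f]]] and ry = r[OF q_le[OF ends(2)[OF f]]]
    have "h (r (q ?y)) ?y \<in> Hom C (r (q ?y)) ?y" "h (r (q ?x)) ?x \<in> Hom C (r (q ?x)) ?x"
        "h (r (q ?x)) (r (q ?y)) \<in> Hom C (r (q ?x)) (r (q ?y))"
      using h e rx ry mono[OF f] by simp_all
    then have "Comp C (h (r (q ?y)) ?y) (h (r (q ?x)) (r (q ?y))) = Comp C f (h (r (q ?x)) ?x)"
      using thin[OF comp comp] arr[OF f] by blast
    then show "Comp C (h (r (q ?y)) ?y) ((?Ga \<circ> ?Fa) f) = Comp C (id f) (h (r (q ?x)) ?x)"
      by simp
  qed
  moreover have "natural_iso ?D ?D (q \<circ> r) (?Fa \<circ> ?Ga) id id (\<lambda>c. (c, c))"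
    unfolding natural_iso_def
  proof (intro conjI ballI)
    fix c assume "c \<in> Obj ?D"
    then have "c \<le> k" by (simp add: ordinal_cat_def)
    then show "(c, c) \<in> Hom ?D ((q \<circ> r) c) (id c)" "is_iso ?D (c, c)"
      using r by (simp_all add: is_iso_ordinal_cat Hom_ordinal_cat)
  next
    fix f assume "f \<in> Arr ?D"
    then obtain i j where ij: "f = (i, j)" "i \<le> j" "j \<le> k" by (auto simp: ordinal_cat_def)
    then have "Dom C (h (r i) (r j)) = r i" "Cod C (h (r i) (r j)) = r j"
      using hr by (auto simp: Hom_def)
    then show "Comp ?D (Cod ?D f, Cod ?D f) ((?Fa \<circ> ?Ga) f) = Comp ?D (id f) (Dom ?D f, Dom ?D f)"
      using ij r[of i] r[of j] by (simp add: ordinal_cat_def)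
  qed
  ultimately show ?thesis
    unfolding equivalent_categories_def using C category_ordinal_cat F G by blast
qed

section \<open>Normal forms of zigzags in the localization\<close>

definition block_arrows :: "nat \<Rightarrow> nat set \<Rightarrow> (nat \<times> nat) set" where
  "block_arrows n S = {(i, j). i \<le> j \<and> j \<le> n \<and> S \<inter> {i<..j} = {}}"

text \<open>Intended is that \<open>bot x\<close> is the least element of the block of
  \<open>x\<close>. Every object then receives a weak equivalence from a chosen representative of
  its block, monotonically in the object.\<close>

context
  fixes n :: nat and W :: "(nat \<times> nat) set" and bot :: "nat \<Rightarrow> nat"
  assumes W: "W \<subseteq> Arr (ordinal_cat n)"
    and bot_W: "\<And>x. x \<le> n \<Longrightarrow> (bot x, x) \<in> W"
    and bot_mono: "\<And>x y. x \<le> y \<Longrightarrow> y \<le> n \<Longrightarrow> bot x \<le> bot y"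
    and bot_eq: "\<And>x y. (x, y) \<in> W \<Longrightarrow> bot x = bot y"
begin

private abbreviation "zeq \<equiv> zigzag_eq (ordinal_cat n) W"

private lemma W_D: "(x, y) \<in> W \<Longrightarrow> x \<le> y" "(x, y) \<in> W \<Longrightarrow> y \<le> n"
  using W by (auto simp: ordinal_cat_def)

private lemma zeq_Fwd_Fwd: "x \<le> y \<Longrightarrow> y \<le> z \<Longrightarrow> z \<le> n \<Longrightarrow> zeq x z [Fwd (x, y), Fwd (y, z)] [Fwd (x, z)]"
  using zeq_Comp[of "(x, y)" "ordinal_cat n" "(y, z)" W] by (simp add: ordinal_cat_def)

private lemma zeq_W: "(x, y) \<in> W \<Longrightarrow> zeq x x [Fwd (x, y), Bwd (x, y)] []"
  "(x, y) \<in> W \<Longrightarrow> zeq y y [Bwd (x, y), Fwd (x, y)] []"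
  using zeq_Fwd_Bwd[of "(x, y)" W "ordinal_cat n"] zeq_Bwd_Fwd[of "(x, y)" W "ordinal_cat n"]
  by (simp_all add: ordinal_cat_def)

private lemma zeq_Fwd_refl: "x \<le> y \<Longrightarrow> y \<le> n \<Longrightarrow> zeq x y [Fwd (x, y)] [Fwd (x, y)]"
  using zigzag_Fwd[of "(x, y)" "ordinal_cat n" W "[]" y]
  by (intro zeq_refl) (simp add: ordinal_cat_def zigzag_Nil)

private lemma zeq_Bwd_refl: "(x, y) \<in> W \<Longrightarrow> zeq y x [Bwd (x, y)] [Bwd (x, y)]"
  using zigzag_Bwd[of "(x, y)" W "ordinal_cat n" "[]" x] W_D[of x y]
  by (intro zeq_refl) (simp add: ordinal_cat_def zigzag_Nil)

text \<open>Naturality of \<open>bot x -> x\<close> with one side inverted: the two composites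
  \<open>bot x -> y\<close> agree in the poset, so an inverse can be moved to the left past a
  forward arrow.\<close>

private lemma zeq_Fwd_Bwd_bot:
  assumes "x \<le> y" "y \<le> n"
  shows "zeq x (bot y) [Fwd (x, y), Bwd (bot y, y)] [Bwd (bot x, x), Fwd (bot x, bot y)]"
proof -
  note b = bot_W[of x] bot_W[of y] bot_mono[OF assms] and xn = le_trans[OF assms]
  note D = W_D[OF b(1)[OF xn]] W_D[OF b(2)[OF assms(2)]]
  let ?B = "[Bwd (bot x, x)]" and ?C = "[Bwd (bot y, y)]"
  have 1: "zeq (bot x) y [Fwd (bot x, x), Fwd (x, y)] [Fwd (bot x, bot y), Fwd (bot y, y)]"
    using zeq_Fwd_Fwd[of "bot x" x y] zeq_Fwd_Fwd[of "bot x" "bot y" y] D assms b(3)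
    by (blast intro: zeq_trans zeq_sym)
  have "zeq x (bot y) ([] @ [Fwd (x, y)] @ ?C) ((?B @ [Fwd (bot x, x)]) @ [Fwd (x, y)] @ ?C)"
    using zeq_append[OF zeq_sym[OF zeq_W(2)[OF b(1)[OF xn]]]
      zeq_append[OF zeq_Fwd_refl[OF assms] zeq_Bwd_refl[OF b(2)[OF assms(2)]]]] by simp
  moreover have "zeq x (bot y) (?B @ [Fwd (bot x, x), Fwd (x, y)] @ ?C)
      (?B @ [Fwd (bot x, bot y), Fwd (bot y, y)] @ ?C)"
    by (intro zeq_append[OF zeq_Bwd_refl] zeq_append[OF 1] zeq_Bwd_refl) (use b xn assms in auto)
  moreover have "zeq x (bot y) ((?B @ [Fwd (bot x, bot y)]) @ [Fwd (bot y, y)] @ ?C)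
      ((?B @ [Fwd (bot x, bot y)]) @ [])"
    by (intro zeq_append[OF zeq_append[OF zeq_Bwd_refl zeq_Fwd_refl]]) (use b xn assms D zeq_W in auto)
  ultimately show ?thesis by (simp, blast intro: zeq_trans)
qed

text \<open>Every zigzag can be rewritten as the descent to \<open>bot x\<close>, the arrow between
  representatives, and the ascent to \<open>y\<close>. As this depends only on the endpoints,
  parallel arrows of the localization coincide.\<close>

private lemma zigzag_normal_form:
  assumes "zigzag (ordinal_cat n) W x us y"
  shows "bot x \<le> bot y \<and> zeq x y us [Bwd (bot x, x), Fwd (bot x, bot y), Fwd (bot y, y)]"
  using assms
proof (induction rule: zigzag.induct)
  case (zigzag_Nil x)
  then have x: "x \<le> n" by (simp add: ordinal_cat_def)
  note b = bot_W[OF x] W_D[OF bot_W[OF x]]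
  have "zeq x x ([Bwd (bot x, x)] @ [Fwd (bot x, bot x), Fwd (bot x, x)])
      ([Bwd (bot x, x)] @ [Fwd (bot x, x)])"
    using zeq_append[OF zeq_Bwd_refl[OF b(1)] zeq_Fwd_Fwd[of "bot x" "bot x" x]] b by simp
  then show ?case using zeq_W(2)[OF b(1)] by (simp, blast intro: zeq_trans zeq_sym)
next
  case (zigzag_Fwd f us y)
  obtain x z where f: "f = (x, z)" "x \<le> z" "z \<le> n" using zigzag_Fwd(1) by (auto simp: ordinal_cat_def)
  have IH: "bot z \<le> bot y" "zeq z y us [Bwd (bot z, z), Fwd (bot z, bot y), Fwd (bot y, y)]"
    and y: "y \<le> n"
    using zigzag_Fwd.IH zigzag_endpoints[OF category_ordinal_cat W zigzag_Fwd(2)] f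
    by (auto simp: ordinal_cat_def)
  note b = bot_mono[OF f(2,3)] bot_W[OF y] W_D[OF bot_W[OF y]] bot_W[OF le_trans[OF f(2,3)]]
  have up: "zeq (bot z) y [Fwd (bot z, bot y), Fwd (bot y, y)] [Fwd (bot z, bot y), Fwd (bot y, y)]"
    using zeq_append[OF zeq_Fwd_refl[of "bot z" "bot y"] zeq_Fwd_refl[of "bot y" y]] IH(1) b by simp
  have "zeq x y ([Fwd (x, z)] @ us) ([Fwd (x, z)] @ [Bwd (bot z, z), Fwd (bot z, bot y), Fwd (bot y, y)])"
    using zeq_append[OF zeq_Fwd_refl IH(2)] f by blast
  \<comment> \<open>The descent from \<open>z\<close> moves to the left past the new arrow; the two
    arrows between representatives then compose.\<close>
  moreover have "zeq x y ([Fwd (x, z), Bwd (bot z, z)] @ [Fwd (bot z, bot y), Fwd (bot y, y)])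
      ([Bwd (bot x, x), Fwd (bot x, bot z)] @ [Fwd (bot z, bot y), Fwd (bot y, y)])"
    using zeq_append[OF zeq_Fwd_Bwd_bot up] f by blast
  moreover have "zeq x y ([Bwd (bot x, x)] @ [Fwd (bot x, bot z), Fwd (bot z, bot y)] @ [Fwd (bot y, y)])
      ([Bwd (bot x, x)] @ [Fwd (bot x, bot y)] @ [Fwd (bot y, y)])"
    by (intro zeq_append[OF zeq_Bwd_refl] zeq_append[OF zeq_Fwd_Fwd] zeq_Fwd_refl) (use b IH(1) in auto)
  ultimately have "zeq x y (Fwd (x, z) # us) [Bwd (bot x, x), Fwd (bot x, bot y), Fwd (bot y, y)]"
    by (simp, blast intro: zeq_trans)
  then show ?case using f b(1) IH(1) by (simp add: ordinal_cat_def)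
next
  case (zigzag_Bwd w us y)
  obtain z x where w: "w = (z, x)" "(z, x) \<in> W" using zigzag_Bwd(1) by (cases w) auto
  note zx = W_D[OF w(2)] bot_eq[OF w(2)]
  have IH: "bot x \<le> bot y" "zeq z y us [Bwd (bot x, z), Fwd (bot x, bot y), Fwd (bot y, y)]"
    and y: "y \<le> n"
    using zigzag_Bwd.IH zigzag_endpoints[OF category_ordinal_cat W zigzag_Bwd(2)] w zx
    by (auto simp: ordinal_cat_def)
  note b = bot_W[OF y] W_D[OF bot_W[OF y]] bot_W[of x] bot_W[of z]
  have up: "zeq (bot x) y [Fwd (bot x, bot y), Fwd (bot y, y)] [Fwd (bot x, bot y), Fwd (bot y, y)]"
    using zeq_append[OF zeq_Fwd_refl[of "bot x" "bot y"] zeq_Fwd_refl[of "bot y" y]] IH(1) b by simp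
  let ?B = "[Bwd (z, x), Bwd (bot x, z)]" and ?x = "bot x"
  have bx: "(?x, x) \<in> W" "(?x, z) \<in> W" using b(4,5) zx by auto
  have B: "zeq x ?x ?B ?B" using zeq_append[OF zeq_Bwd_refl[OF w(2)] zeq_Bwd_refl[OF bx(2)]] by simp
  \<comment> \<open>The two consecutive inverses equal a single one: insert the descent to
    \<open>?x\<close> and its return, route the return through \<open>z\<close>, and cancel from the
    inside out. Here \<open>bot z = bot x\<close> matters.\<close>
  have "zeq x ?x ([] @ ?B) (([Bwd (?x, x)] @ [Fwd (?x, x)]) @ ?B)"
    using zeq_append[OF zeq_sym[OF zeq_W(2)[OF bx(1)]] B] by simp
  moreover have "zeq x ?x ([Bwd (?x, x)] @ [Fwd (?x, x)] @ ?B) ([Bwd (?x, x)] @ [Fwd (?x, z), Fwd (z, x)] @ ?B)"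
    by (intro zeq_append[OF zeq_Bwd_refl[OF bx(1)]] zeq_append[OF _ B] zeq_sym[OF zeq_Fwd_Fwd])
      (use W_D[OF bx(2)] zx in auto)
  moreover have "zeq x ?x ([Bwd (?x, x), Fwd (?x, z)] @ [Fwd (z, x), Bwd (z, x)] @ [Bwd (?x, z)])
      ([Bwd (?x, x), Fwd (?x, z)] @ [] @ [Bwd (?x, z)])"
    using zeq_append[OF zeq_append[OF zeq_Bwd_refl[OF bx(1)] zeq_Fwd_refl]
      zeq_append[OF zeq_W(1)[OF w(2)] zeq_Bwd_refl[OF bx(2)]]] W_D[OF bx(2)] by simp
  moreover have "zeq x ?x ([Bwd (?x, x)] @ [Fwd (?x, z), Bwd (?x, z)]) ([Bwd (?x, x)] @ [])"
    using zeq_append[OF zeq_Bwd_refl[OF bx(1)] zeq_W(1)[OF bx(2)]] by simp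
  ultimately have BB: "zeq x ?x ?B [Bwd (?x, x)]" by (simp, blast intro: zeq_trans)
  have "zeq x y ([Bwd (z, x)] @ us) ([Bwd (z, x)] @ [Bwd (?x, z), Fwd (?x, bot y), Fwd (bot y, y)])"
    using zeq_append[OF zeq_Bwd_refl[OF w(2)] IH(2)] .
  moreover have "zeq x y (?B @ [Fwd (?x, bot y), Fwd (bot y, y)]) ([Bwd (?x, x)] @ [Fwd (?x, bot y), Fwd (bot y, y)])"
    using zeq_append[OF BB up] .
  ultimately have "zeq x y (Bwd (z, x) # us) [Bwd (?x, x), Fwd (?x, bot y), Fwd (bot y, y)]"
    by (simp, blast intro: zeq_trans)
  then show ?case using w IH(1) by (simp add: ordinal_cat_def)
qed

lemma localization_thin:
  assumes "f \<in> Hom (localization (ordinal_cat n) W) x y" "g \<in> Hom (localization (ordinal_cat n) W) x y"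
  shows "f = g"
proof -
  obtain us vs where us: "zigzag (ordinal_cat n) W x us y" "f = (x, zigzag_class (ordinal_cat n) W x y us, y)"
    and vs: "zigzag (ordinal_cat n) W x vs y" "g = (x, zigzag_class (ordinal_cat n) W x y vs, y)"
    using assms unfolding in_Hom_localization by blast
  have "zeq x y us vs"
    using zigzag_normal_form[OF us(1)] zigzag_normal_form[OF vs(1)] by (blast intro: zeq_trans zeq_sym)
  then show ?thesis using zigzag_class_eq_iff[OF us(1)] us(2) vs(2) by blast
qed

lemma localization_Hom_nonempty:
  assumes "x \<le> n" "y \<le> n"
  shows "Hom (localization (ordinal_cat n) W) x y \<noteq> {} \<longleftrightarrow> bot x \<le> bot y"
proof -
  have "\<exists>us. zigzag (ordinal_cat n) W x us y" if "bot x \<le> bot y"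
  proof -
    note b = bot_W[OF assms(1)] bot_W[OF assms(2)] W_D[OF bot_W[OF assms(2)]]
    \<comment> \<open>Relating the list to itself is enough, since both sides of
      \<open>zigzag_eq\<close> are zigzags.\<close>
    have "zeq x y ([Bwd (bot x, x)] @ [Fwd (bot x, y)]) ([Bwd (bot x, x)] @ [Fwd (bot x, y)])"
      by (intro zeq_append[OF zeq_Bwd_refl[OF b(1)]] zeq_Fwd_refl) (use that b in auto)
    then show ?thesis using zigzag_eq_zigzag[OF category_ordinal_cat W] by blast
  qed
  then show ?thesis
    using zigzag_normal_form in_Hom_localization by (metis ex_in_conv)
qed

end

section \<open>The homotopy category counts blocks\<close>

lemma inv_into_factor:
  assumes "x \<in> A" "\<And>y. y \<in> A \<Longrightarrow> u x = u y \<Longrightarrow> v x = v y"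
  shows "v (inv_into A u (u x)) = v x"
  using assms by (metis f_inv_into_f imageI inv_into_into)

text \<open>Both images are the quotient of \<open>A\<close> by the same equivalence
  relation.\<close>

lemma card_image_eq_card_image:
  assumes "\<And>x y. x \<in> A \<Longrightarrow> y \<in> A \<Longrightarrow> f x = f y \<longleftrightarrow> g x = g y"
  shows "card (f ` A) = card (g ` A)"
proof (rule card_eq_witness)
  show "(f \<circ> inv_into A g) z \<in> f ` A \<and> (g \<circ> inv_into A f) ((f \<circ> inv_into A g) z) = z"
    if z: "z \<in> g ` A" for z
  proof -
    note A = inv_into_into[OF z]
    have "g (inv_into A f (f (inv_into A g z))) = g (inv_into A g z)"
      by (rule inv_into_factor[OF A]) (use assms[OF A] in blast)
    then show ?thesis using A f_inv_into_f[OF z] by simp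
  qed
  show "(g \<circ> inv_into A f) z \<in> g ` A \<and> (f \<circ> inv_into A g) ((g \<circ> inv_into A f) z) = z"
    if z: "z \<in> f ` A" for z
  proof -
    note A = inv_into_into[OF z]
    have "f (inv_into A g (g (inv_into A f z))) = f (inv_into A f z)"
      by (rule inv_into_factor[OF A]) (use assms[OF A] in blast)
    then show ?thesis using A f_inv_into_f[OF z] by simp
  qed
qed

text \<open>The localization is the preorder pulled back along \<open>bot\<close>, whose image is
  \<open>S\<close>; up to equivalence it is the chain \<open>S\<close>.\<close>

lemma homotopy_category_block_arrows:
  assumes S: "S \<subseteq> {0..n}" "0 \<in> S"
  shows "equivalent_categories (localization (ordinal_cat n) (block_arrows n S)) (ordinal_cat k)
    \<longleftrightarrow> card S = Suc k"
proof -
  define bot where "bot = (\<lambda>x. Max (S \<inter> {..x}))"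
  have fin: "finite S" using S finite_subset by blast
  \<comment> \<open>The assumption \<open>0 \<in> S\<close> keeps the argument of \<open>Max\<close>
    nonempty.\<close>
  have "bot x \<in> S \<inter> {..x}" for x
    unfolding bot_def by (rule Max_in) (use fin S in auto)
  then have bot_in: "bot x \<in> S" "bot x \<le> x" for x by auto
  have bot_ge: "s \<le> bot x" if "s \<in> S" "s \<le> x" for s x
    using that fin unfolding bot_def by simp
  have bot_id: "bot s = s" if "s \<in> S" for s
    using bot_in[of s] bot_ge[OF that, of s] by simp
  let ?W = "block_arrows n S" and ?C = "ordinal_cat n"
  have W: "?W \<subseteq> Arr ?C" by (auto simp: block_arrows_def ordinal_cat_def)
  have bot_W: "(bot x, x) \<in> ?W" if "x \<le> n" for x
    using that bot_in[of x] bot_ge[of _ x] by (force simp: block_arrows_def)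
  have bot_mono: "bot x \<le> bot y" if "x \<le> y" "y \<le> n" for x y
    using that bot_in[of x] bot_ge[of _ y] by simp
  have bot_eq: "bot x = bot y" if "(x, y) \<in> ?W" for x y
  proof -
    have "x \<le> y" "bot y \<notin> {x<..y}" using that bot_in(1)[of y] by (auto simp: block_arrows_def)
    then have "bot y \<le> x" using bot_in(2)[of y] by auto
    then show ?thesis using bot_in[of x] bot_in[of y] bot_ge[of _ x] bot_ge[of _ y] \<open>x \<le> y\<close>
      by (meson le_antisym le_trans)
  qed
  let ?L = "localization ?C ?W"
  have L: "category ?L" by (rule category_localization[OF category_ordinal_cat W])
  have Obj: "Obj ?L = {0..n}" by (simp add: localization_def ordinal_cat_def)
  have Hom: "Hom ?L x y \<noteq> {} \<longleftrightarrow> bot x \<le> bot y" if "x \<in> Obj ?L" "y \<in> Obj ?L" for x y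
    using localization_Hom_nonempty[OF W bot_W bot_mono bot_eq] that Obj by simp
  have thin: "f = g" if "f \<in> Hom ?L x y" "g \<in> Hom ?L x y" for f g x y
    using localization_thin[OF W bot_W bot_mono bot_eq] that by blast
  have bot_image: "bot ` {0..n} = S"
    using bot_in bot_id S by (force simp: image_iff)
  show ?thesis
  proof
    assume "equivalent_categories ?L (ordinal_cat k)"
    then obtain F where F: "F ` Obj ?L = {0..k}"
      and FH: "\<And>x y. x \<in> Obj ?L \<Longrightarrow> y \<in> Obj ?L \<Longrightarrow> Hom ?L x y \<noteq> {} \<longleftrightarrow> F x \<le> F y"
      by (rule equivalent_ordinal_catE) blast
    \<comment> \<open>Both maps induce the preorder given by nonempty hom sets, hence have the same
      fibres.\<close>
    have "F x = F y \<longleftrightarrow> bot x = bot y" if "x \<in> Obj ?L" "y \<in> Obj ?L" for x y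
      using FH Hom that by (metis le_antisym order_refl)
    then have "card (F ` Obj ?L) = card (bot ` Obj ?L)" by (rule card_image_eq_card_image)
    then show "card S = Suc k" unfolding F unfolding Obj bot_image by simp
  next
    assume card: "card S = Suc k"
    \<comment> \<open>Numbering the starts from 0 is the order isomorphism of \<open>S\<close> with
      \<open>{0..k}\<close>.\<close>
    define rank where "rank = (\<lambda>s. card {t \<in> S. t < s})"
    have rank_less: "rank s < rank t" if "s \<in> S" "s < t" for s t
      unfolding rank_def using that fin by (intro psubset_card_mono) auto
    then have rank_le: "rank s \<le> rank t \<longleftrightarrow> s \<le> t" if "s \<in> S" "t \<in> S" for s t
      using that by (metis le_less linorder_not_le)
    have "rank ` S \<subseteq> {0..k}"
    proof clarify
      fix s assume "s \<in> S"
      then have "rank s < card S"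
        unfolding rank_def using fin by (intro psubset_card_mono) auto
      then show "rank s \<in> {0..k}" using card by simp
    qed
    moreover have "inj_on rank S"
      using rank_le by (metis inj_onI le_antisym order_refl)
    then have "card (rank ` S) = card {0..k}" using card by (simp add: card_image)
    ultimately have "rank ` S = {0..k}" by (simp add: card_subset_eq)
    then have q: "(rank \<circ> bot) ` Obj ?L = {0..k}" unfolding Obj image_comp[symmetric] bot_image .
    show "equivalent_categories ?L (ordinal_cat k)"
    proof (rule thin_equivalent_ordinal_cat[OF L _ q])
      show "f = g" if "f \<in> Hom ?L x y" "g \<in> Hom ?L x y" for f g x y using thin that .
      show "Hom ?L x y \<noteq> {} \<longleftrightarrow> (rank \<circ> bot) x \<le> (rank \<circ> bot) y"
        if "x \<in> Obj ?L" "y \<in> Obj ?L" for x y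
        using Hom[OF that] rank_le bot_in by simp
    qed
  qed
qed

section \<open>Model structures on finite ordinals\<close>

lemma ordinal_cat_simps:
  "Dom (ordinal_cat n) = fst" "Cod (ordinal_cat n) = snd" "Ident (ordinal_cat n) i = (i, i)"
  "Comp (ordinal_cat n) g f = (fst f, snd g)" "f \<in> Arr (ordinal_cat n) \<longleftrightarrow> fst f \<le> snd f \<and> snd f \<le> n"
  by (auto simp: ordinal_cat_def)

lemma has_lifting_ordinal_cat:
  assumes "i \<le> j" "j \<le> n" "a \<le> b" "b \<le> n"
  shows "has_lifting (ordinal_cat n) (i, j) (a, b) \<longleftrightarrow> (i \<le> a \<and> j \<le> b \<longrightarrow> j \<le> a)"
proof -
  have "has_lifting (ordinal_cat n) (i, j) (a, b) \<longleftrightarrow>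
      (i \<le> a \<and> j \<le> b \<longrightarrow> (\<exists>d \<in> Hom (ordinal_cat n) j a. fst d = j \<and> snd d = a))"
    using assms unfolding has_lifting_def ordinal_cat_simps by (simp add: Hom_ordinal_cat)
  also have "\<dots> \<longleftrightarrow> (i \<le> a \<and> j \<le> b \<longrightarrow> j \<le> a)"
    using assms by (simp add: Hom_ordinal_cat)
  finally show ?thesis .
qed

text \<open>A retract diagram has arrows in both directions between corresponding endpoints, so
  antisymmetry applies.\<close>

lemma retract_of_ordinal_cat:
  assumes "retract_of (ordinal_cat n) f g"
  shows "f = g"
proof -
  obtain i j a b where "f = (i, j)" "g = (a, b)" by (metis surj_pair)
  then show ?thesis
    using assms unfolding retract_of_def ordinal_cat_simps Hom_ordinal_cat
    by (auto split: if_splits)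
qed

lemma weak_factorization_system_ordinal_cat:
  "weak_factorization_system (ordinal_cat n) L R \<longleftrightarrow>
     (\<forall>i j. (i, j) \<in> L \<longrightarrow> i \<le> j \<and> j \<le> n) \<and> (\<forall>i j. (i, j) \<in> R \<longrightarrow> i \<le> j \<and> j \<le> n) \<and>
     (\<forall>i j. i \<le> j \<and> j \<le> n \<longrightarrow> (\<exists>m. (i, m) \<in> L \<and> (m, j) \<in> R)) \<and>
     (\<forall>i j a b. (i, j) \<in> L \<and> (a, b) \<in> R \<and> i \<le> a \<and> j \<le> b \<longrightarrow> j \<le> a)"
proof -
  let ?C = "ordinal_cat n"
  have retract: "retract_closed ?C X" for X
    unfolding retract_closed_def using retract_of_ordinal_cat by blast
  have Arr: "X \<subseteq> Arr ?C \<longleftrightarrow> (\<forall>i j. (i, j) \<in> X \<longrightarrow> i \<le> j \<and> j \<le> n)" for X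
    by (auto simp: ordinal_cat_simps)
  have fac: "(\<exists>f \<in> L. \<exists>p \<in> R. Cod ?C f = Dom ?C p \<and> Comp ?C p f = (i, j)) \<longleftrightarrow>
      (\<exists>m. (i, m) \<in> L \<and> (m, j) \<in> R)" for i j
    unfolding ordinal_cat_simps by force
  have "(\<forall>f \<in> Arr ?C. P f) \<longleftrightarrow> (\<forall>i j. i \<le> j \<and> j \<le> n \<longrightarrow> P (i, j))" for P
    by (auto simp: ordinal_cat_simps)
  note fac' = this[of "\<lambda>f. \<exists>i \<in> L. \<exists>p \<in> R. Cod ?C i = Dom ?C p \<and> Comp ?C p i = f", unfolded fac]
  have lift: "(\<forall>i \<in> L. \<forall>p \<in> R. has_lifting ?C i p) \<longleftrightarrow>
      (\<forall>i j a b. (i, j) \<in> L \<and> (a, b) \<in> R \<and> i \<le> a \<and> j \<le> b \<longrightarrow> j \<le> a)"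
    if L: "\<forall>i j. (i, j) \<in> L \<longrightarrow> i \<le> j \<and> j \<le> n" and R: "\<forall>i j. (i, j) \<in> R \<longrightarrow> i \<le> j \<and> j \<le> n"
  proof -
    have "has_lifting ?C (i, j) (a, b) \<longleftrightarrow> (i \<le> a \<and> j \<le> b \<longrightarrow> j \<le> a)"
      if "(i, j) \<in> L" "(a, b) \<in> R" for i j a b
      using that L R by (intro has_lifting_ordinal_cat) blast+
    then show ?thesis unfolding Ball_def split_paired_All by blast
  qed
  show ?thesis
    unfolding weak_factorization_system_def Arr fac' by (simp add: retract lift cong: conj_cong)
qed

lemma weak_factorization_systemD:
  assumes "weak_factorization_system (ordinal_cat n) L R"
  shows "(i, j) \<in> L \<Longrightarrow> i \<le> j" "(i, j) \<in> L \<Longrightarrow> j \<le> n" "(i, j) \<in> R \<Longrightarrow> i \<le> j" "(i, j) \<in> R \<Longrightarrow> j \<le> n"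
    and "i \<le> j \<Longrightarrow> j \<le> n \<Longrightarrow> \<exists>m. i \<le> m \<and> m \<le> j \<and> (i, m) \<in> L \<and> (m, j) \<in> R"
    and "(i, j) \<in> L \<Longrightarrow> (a, b) \<in> R \<Longrightarrow> i \<le> a \<Longrightarrow> j \<le> b \<Longrightarrow> j \<le> a"
proof -
  note W = assms[unfolded weak_factorization_system_ordinal_cat]
  have L: "i \<le> j \<and> j \<le> n" if "(i, j) \<in> L" for i j using W that by blast
  have R: "i \<le> j \<and> j \<le> n" if "(i, j) \<in> R" for i j using W that by blast
  have fac: "\<exists>m. (i, m) \<in> L \<and> (m, j) \<in> R" if "i \<le> j \<and> j \<le> n" for i j
    using W that by (elim conjE) (rule allE, assumption, blast)
  have lift: "j \<le> a" if "(i, j) \<in> L \<and> (a, b) \<in> R \<and> i \<le> a \<and> j \<le> b" for i j a b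
    using W that by (elim conjE) iprover
  show "(i, j) \<in> L \<Longrightarrow> i \<le> j" "(i, j) \<in> L \<Longrightarrow> j \<le> n"
    "(i, j) \<in> R \<Longrightarrow> i \<le> j" "(i, j) \<in> R \<Longrightarrow> j \<le> n" using L R by simp_all
  show "\<exists>m. i \<le> m \<and> m \<le> j \<and> (i, m) \<in> L \<and> (m, j) \<in> R" if "i \<le> j" "j \<le> n"
    using fac[of i j] L R that by blast
  show "j \<le> a" if "(i, j) \<in> L" "(a, b) \<in> R" "i \<le> a" "j \<le> b" using lift[of i j a b] that by simp
qed

lemma weak_factorization_systemI:
  assumes "\<And>i j. (i, j) \<in> L \<Longrightarrow> i \<le> j \<and> j \<le> n" "\<And>i j. (i, j) \<in> R \<Longrightarrow> i \<le> j \<and> j \<le> n"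
    and "\<And>i j. i \<le> j \<Longrightarrow> j \<le> n \<Longrightarrow> \<exists>m. (i, m) \<in> L \<and> (m, j) \<in> R"
    and "\<And>i j a b. (i, j) \<in> L \<Longrightarrow> (a, b) \<in> R \<Longrightarrow> i \<le> a \<Longrightarrow> j \<le> b \<Longrightarrow> j \<le> a"
  shows "weak_factorization_system (ordinal_cat n) L R"
proof -
  have "\<forall>i j. (i, j) \<in> L \<longrightarrow> i \<le> j \<and> j \<le> n" "\<forall>i j. (i, j) \<in> R \<longrightarrow> i \<le> j \<and> j \<le> n"
      "\<forall>i j. i \<le> j \<and> j \<le> n \<longrightarrow> (\<exists>m. (i, m) \<in> L \<and> (m, j) \<in> R)"
    using assms(1-3) by simp_all
  moreover have "\<forall>i j a b. (i, j) \<in> L \<and> (a, b) \<in> R \<and> i \<le> a \<and> j \<le> b \<longrightarrow> j \<le> a"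
    by (intro allI impI, elim conjE) (rule assms(4))
  ultimately show ?thesis
    unfolding weak_factorization_system_ordinal_cat by (intro conjI)
qed

definition left_lifting :: "nat \<Rightarrow> (nat \<times> nat) set \<Rightarrow> (nat \<times> nat) set" where
  "left_lifting n R = {(i, j). i \<le> j \<and> j \<le> n \<and> (\<forall>a b. (a, b) \<in> R \<longrightarrow> i \<le> a \<longrightarrow> j \<le> b \<longrightarrow> j \<le> a)}"

definition right_lifting :: "nat \<Rightarrow> (nat \<times> nat) set \<Rightarrow> (nat \<times> nat) set" where
  "right_lifting n L = {(a, b). a \<le> b \<and> b \<le> n \<and> (\<forall>i j. (i, j) \<in> L \<longrightarrow> i \<le> a \<longrightarrow> j \<le> b \<longrightarrow> j \<le> a)}"

lemma left_liftingD:
  assumes "(i, j) \<in> left_lifting n R"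
  shows "i \<le> j" "j \<le> n" "(a, b) \<in> R \<Longrightarrow> i \<le> a \<Longrightarrow> j \<le> b \<Longrightarrow> j \<le> a"
  using assms unfolding left_lifting_def by blast+

lemma left_liftingI:
  assumes "i \<le> j" "j \<le> n" "\<And>a b. (a, b) \<in> R \<Longrightarrow> i \<le> a \<Longrightarrow> j \<le> b \<Longrightarrow> j \<le> a"
  shows "(i, j) \<in> left_lifting n R"
  using assms unfolding left_lifting_def by blast

lemma right_liftingD:
  assumes "(a, b) \<in> right_lifting n L"
  shows "a \<le> b" "b \<le> n" "(i, j) \<in> L \<Longrightarrow> i \<le> a \<Longrightarrow> j \<le> b \<Longrightarrow> j \<le> a"
  using assms unfolding right_lifting_def by blast+

lemma right_liftingI:
  assumes "a \<le> b" "b \<le> n" "\<And>i j. (i, j) \<in> L \<Longrightarrow> i \<le> a \<Longrightarrow> j \<le> b \<Longrightarrow> j \<le> a"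
  shows "(a, b) \<in> right_lifting n L"
  using assms unfolding right_lifting_def by blast

lemma left_lifting_refl: "i \<le> n \<Longrightarrow> (i, i) \<in> left_lifting n R"
  by (rule left_liftingI) simp_all

text \<open>For \<open>i \<le> m \<le> j\<close> the arrow \<open>(m, j)\<close> is the pushout of
  \<open>(i, j)\<close> along \<open>(i, m)\<close>; for \<open>m\<close> beyond \<open>j\<close>
  the pushout is an identity.\<close>

lemma left_lifting_pushout:
  assumes "(i, j) \<in> left_lifting n R" "i \<le> m" "m \<le> j"
  shows "(m, j) \<in> left_lifting n R"
proof (rule left_liftingI)
  fix a b assume "(a, b) \<in> R" "m \<le> a" "j \<le> b"
  then show "j \<le> a" using left_liftingD(3)[OF assms(1)] assms(2) by simp
qed (use left_liftingD(2)[OF assms(1)] assms(3) in simp_all)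

lemma left_lifting_trans:
  assumes "(i, j) \<in> left_lifting n R" "(j, l) \<in> left_lifting n R"
  shows "(i, l) \<in> left_lifting n R"
proof (rule left_liftingI)
  fix a b assume ab: "(a, b) \<in> R" "i \<le> a" "l \<le> b"
  then have "j \<le> a" using left_liftingD(3)[OF assms(1)] left_liftingD(1)[OF assms(2)] by simp
  then show "l \<le> a" using left_liftingD(3)[OF assms(2)] ab by simp
qed (use left_liftingD(1)[OF assms(1)] left_liftingD(1,2)[OF assms(2)] in simp_all)

lemma right_lifting_refl: "i \<le> n \<Longrightarrow> (i, i) \<in> right_lifting n L"
  by (rule right_liftingI) simp_all

lemma right_lifting_pullback:
  assumes "(a, b) \<in> right_lifting n L" "a \<le> m" "m \<le> b"
  shows "(a, m) \<in> right_lifting n L"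
proof (rule right_liftingI)
  fix i j assume "(i, j) \<in> L" "i \<le> a" "j \<le> m"
  then show "j \<le> a" using right_liftingD(3)[OF assms(1)] assms(3) by simp
qed (use right_liftingD(2)[OF assms(1)] assms(2,3) in simp_all)

lemma right_lifting_trans:
  assumes "(a, b) \<in> right_lifting n L" "(b, c) \<in> right_lifting n L"
  shows "(a, c) \<in> right_lifting n L"
proof (rule right_liftingI)
  fix i j assume ij: "(i, j) \<in> L" "i \<le> a" "j \<le> c"
  then have "j \<le> b" using right_liftingD(3)[OF assms(2)] right_liftingD(1)[OF assms(1)] by simp
  then show "j \<le> a" using right_liftingD(3)[OF assms(1)] ij by simp
qed (use right_liftingD(1)[OF assms(1)] right_liftingD(1,2)[OF assms(2)] in simp_all)

text \<open>The retract argument: an arrow that lifts against the right factor of its own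
  factorization through \<open>m\<close> forces \<open>m = j\<close>.\<close>

lemma weak_factorization_system_left_lifting:
  assumes "weak_factorization_system (ordinal_cat n) L R"
  shows "L = left_lifting n R"
proof (intro subset_antisym subrelI)
  note D = weak_factorization_systemD[OF assms]
  show "(i, j) \<in> left_lifting n R" if "(i, j) \<in> L" for i j
    using D(1,2)[OF that] D(6)[OF that] by (rule left_liftingI)
  show "(i, j) \<in> L" if l: "(i, j) \<in> left_lifting n R" for i j
  proof -
    obtain m where m: "i \<le> m" "m \<le> j" "(i, m) \<in> L" "(m, j) \<in> R"
      using D(5) left_liftingD(1,2)[OF l] by blast
    then have "m = j" using left_liftingD(3)[OF l m(4,1)] by simp
    then show ?thesis using m by simp
  qed
qed

lemma weak_factorization_system_right_lifting:
  assumes "weak_factorization_system (ordinal_cat n) L R"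
  shows "R = right_lifting n L"
proof (intro subset_antisym subrelI)
  note D = weak_factorization_systemD[OF assms]
  show "(i, j) \<in> right_lifting n L" if "(i, j) \<in> R" for i j
    using D(3,4)[OF that] D(6)[OF _ that] by (rule right_liftingI)
  show "(i, j) \<in> R" if r: "(i, j) \<in> right_lifting n L" for i j
  proof -
    obtain m where m: "i \<le> m" "m \<le> j" "(i, m) \<in> L" "(m, j) \<in> R"
      using D(5) right_liftingD(1,2)[OF r] by blast
    then have "m = i" using right_liftingD(3)[OF r m(3)] by simp
    then show ?thesis using m by simp
  qed
qed

section \<open>Weak equivalences as interval partitions\<close>

lemma two_out_of_three_ordinal_cat:
  "two_out_of_three (ordinal_cat n) W \<longleftrightarrow> (\<forall>i j l. i \<le> j \<and> j \<le> l \<and> l \<le> n \<longrightarrow>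
     ((i, j) \<in> W \<and> (j, l) \<in> W \<longrightarrow> (i, l) \<in> W) \<and>
     ((i, j) \<in> W \<and> (i, l) \<in> W \<longrightarrow> (j, l) \<in> W) \<and>
     ((j, l) \<in> W \<and> (i, l) \<in> W \<longrightarrow> (i, j) \<in> W))"
proof -
  have "(\<forall>f \<in> Arr (ordinal_cat n). \<forall>g \<in> Arr (ordinal_cat n). snd f = fst g \<longrightarrow> P f g (fst f, snd g)) \<longleftrightarrow>
      (\<forall>i j l. i \<le> j \<and> j \<le> l \<and> l \<le> n \<longrightarrow> P (i, j) (j, l) (i, l))" for P
  proof (intro iffI allI impI ballI)
    fix i j l :: nat
    assume "\<forall>f \<in> Arr (ordinal_cat n). \<forall>g \<in> Arr (ordinal_cat n).
        snd f = fst g \<longrightarrow> P f g (fst f, snd g)" and ijl: "i \<le> j \<and> j \<le> l \<and> l \<le> n"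
    moreover have "(i, j) \<in> Arr (ordinal_cat n)" "(j, l) \<in> Arr (ordinal_cat n)"
      using ijl by (simp_all add: ordinal_cat_simps)
    ultimately have "snd (i, j) = fst (j, l) \<longrightarrow> P (i, j) (j, l) (fst (i, j), snd (j, l))" by blast
    then show "P (i, j) (j, l) (i, l)" by simp
  qed (auto simp: ordinal_cat_simps)
  from this[of "\<lambda>f g h. (f \<in> W \<and> g \<in> W \<longrightarrow> h \<in> W) \<and> (f \<in> W \<and> h \<in> W \<longrightarrow> g \<in> W) \<and>
      (g \<in> W \<and> h \<in> W \<longrightarrow> f \<in> W)"]
  show ?thesis unfolding two_out_of_three_def ordinal_cat_simps(1,2,4) .
qed

text \<open>A partition into intervals is known once it is known which neighbours are joined, so
  only arrows of length one are tested. The case \<open>s = 0\<close> is separate because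
  \<open>0 - 1 = 0\<close> in the natural numbers.\<close>

definition block_starts :: "nat \<Rightarrow> (nat \<times> nat) set \<Rightarrow> nat set" where
  "block_starts n W = {s. s \<le> n \<and> (s = 0 \<or> (s - 1, s) \<notin> W)}"

lemma block_starts_block_arrows:
  assumes "S \<subseteq> {0..n}" "0 \<in> S"
  shows "block_starts n (block_arrows n S) = S"
proof -
  have "{s - 1<..s} = {s}" if "s \<noteq> 0" for s :: nat using that by auto
  then have "(s - 1, s) \<in> block_arrows n S \<longleftrightarrow> s \<notin> S" if "s \<noteq> 0" "s \<le> n" for s
    using that by (simp add: block_arrows_def)
  then have "s \<in> block_starts n (block_arrows n S) \<longleftrightarrow> s \<in> S" for s
    using assms unfolding block_starts_def by (cases "s = 0") auto
  then show ?thesis by blast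
qed

text \<open>Convexity breaks an arrow of \<open>W\<close> into arrows of length one, and
  transitivity puts them together again.\<close>

lemma block_arrows_block_starts:
  assumes W: "\<And>i j. (i, j) \<in> W \<Longrightarrow> i \<le> j \<and> j \<le> n" "\<And>i. i \<le> n \<Longrightarrow> (i, i) \<in> W"
    and trans: "\<And>i j l. (i, j) \<in> W \<Longrightarrow> (j, l) \<in> W \<Longrightarrow> (i, l) \<in> W"
    and convex: "\<And>i m j. (i, j) \<in> W \<Longrightarrow> i \<le> m \<Longrightarrow> m \<le> j \<Longrightarrow> (i, m) \<in> W \<and> (m, j) \<in> W"
  shows "block_arrows n (block_starts n W) = W"
proof -
  have "(i, j) \<in> block_arrows n (block_starts n W) \<longleftrightarrow> (i, j) \<in> W" for i j
  proof
    assume ij: "(i, j) \<in> W"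
    have "s \<notin> block_starts n W" if "i < s" "s \<le> j" for s
    proof -
      have "(i, s) \<in> W" using convex[OF ij] that by simp
      then have "(s - 1, s) \<in> W" using convex[of i s "s - 1"] that by simp
      then show ?thesis using that by (simp add: block_starts_def)
    qed
    then show "(i, j) \<in> block_arrows n (block_starts n W)"
      using W(1)[OF ij] unfolding block_arrows_def by auto
  next
    assume "(i, j) \<in> block_arrows n (block_starts n W)"
    then have "i \<le> j" "j \<le> n" and no: "\<And>s. i < s \<Longrightarrow> s \<le> j \<Longrightarrow> s \<notin> block_starts n W"
      unfolding block_arrows_def by auto
    from this show "(i, j) \<in> W"
    proof (induction j rule: dec_induct)
      case base
      then show ?case using W(2) by simp
    next
      case (step m)
      have "(i, m) \<in> W" using step.IH step.prems by simp
      moreover have "(m, Suc m) \<in> W"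
        using step.prems(2)[of "Suc m"] step.prems(1) step.hyps by (simp add: block_starts_def)
      ultimately show ?case by (rule trans)
    qed
  qed
  then show ?thesis by (intro subset_antisym subrelI) blast+
qed

lemma model_structure_ordinal_cat:
  "model_structure (ordinal_cat n) W C F \<longleftrightarrow>
     W \<subseteq> Arr (ordinal_cat n) \<and> two_out_of_three (ordinal_cat n) W \<and>
     weak_factorization_system (ordinal_cat n) C (W \<inter> F) \<and>
     weak_factorization_system (ordinal_cat n) (W \<inter> C) F"
proof -
  have "L \<subseteq> Arr (ordinal_cat n) \<and> R \<subseteq> Arr (ordinal_cat n)"
    if "weak_factorization_system (ordinal_cat n) L R" for L R
    using that by (simp add: weak_factorization_system_def)
  then show ?thesis
    unfolding model_structure_def
    using category_ordinal_cat has_finite_limits_ordinal_cat has_finite_colimits_ordinal_cat by blast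
qed

section \<open>Model structures correspond to blocked transfer systems\<close>

lemma model_structure_imp_blocked_transfer:
  assumes "model_structure (ordinal_cat n) W C F"
  shows "W = block_arrows n (block_starts n W)"
    and "blocked_transfer n 0 (block_starts n W) (W \<inter> F)"
    and "C = left_lifting n (W \<inter> F)" "F = right_lifting n (W \<inter> C)"
proof -
  note M = assms[unfolded model_structure_ordinal_cat]
  have W: "i \<le> j" "j \<le> n" if "(i, j) \<in> W" for i j
    using M that by (auto simp: ordinal_cat_def)
  have W3: "(i, j) \<in> W \<Longrightarrow> (j, l) \<in> W \<Longrightarrow> (i, l) \<in> W"
      "(i, j) \<in> W \<Longrightarrow> (i, l) \<in> W \<Longrightarrow> (j, l) \<in> W"
      "(j, l) \<in> W \<Longrightarrow> (i, l) \<in> W \<Longrightarrow> (i, j) \<in> W"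
    if "i \<le> j" "j \<le> l" "l \<le> n" for i j l
    using M that unfolding two_out_of_three_ordinal_cat by blast+
  have w1: "weak_factorization_system (ordinal_cat n) C (W \<inter> F)"
    and w2: "weak_factorization_system (ordinal_cat n) (W \<inter> C) F" using M by simp_all
  note C = weak_factorization_system_left_lifting[OF w1]
  note AF = weak_factorization_system_right_lifting[OF w1]
  note AC = weak_factorization_system_left_lifting[OF w2]
  note F = weak_factorization_system_right_lifting[OF w2]
  note AC_pushout = left_lifting_pushout[where R = F and n = n, folded AC]
  note AF_pullback = right_lifting_pullback[where L = C and n = n, folded AF]
  have refl: "(i, i) \<in> W" if "i \<le> n" for i
    using right_lifting_refl[OF that, of C, folded AF] by simp
  have left: "(i, m) \<in> W" if ij: "(i, j) \<in> W" and m: "i \<le> m" "m \<le> j" for i m j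
  proof -
    \<comment> \<open>By 2-out-of-3 the cofibration \<open>(i, p)\<close> is acyclic. A point
      \<open>m\<close> up to \<open>p\<close> is reached through the pushout \<open>(m, p)\<close>,
      a later one through the pullback \<open>(p, m)\<close> of the acyclic fibration.\<close>
    obtain p where p: "i \<le> p" "p \<le> j" "(i, p) \<in> C" "(p, j) \<in> W \<inter> F"
      using weak_factorization_systemD(5)[OF w1 W(1,2)[OF ij]] by blast
    then have ip: "(i, p) \<in> W" using W3(3)[OF p(1,2) W(2)[OF ij]] ij by blast
    show ?thesis
    proof (cases "m \<le> p")
      case True
      then have "(m, p) \<in> W" using AC_pushout[of i p m] ip p(3) m(1) by blast
      then show ?thesis using W3(3)[OF m(1) True] p(2) W(2)[OF ij] ip by simp
    next
      case False
      then have "(p, m) \<in> W" using AF_pullback[OF p(4), of m] m(2) by simp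
      then show ?thesis using W3(1)[of i p m] ip p(1) m W(2)[OF ij] False by simp
    qed
  qed
  have convex: "(i, m) \<in> W \<and> (m, j) \<in> W" if ij: "(i, j) \<in> W" and m: "i \<le> m" "m \<le> j" for i m j
    using left[OF ij m] W3(2)[OF m W(2)[OF ij]] ij by blast
  show WS: "W = block_arrows n (block_starts n W)"
  proof (rule block_arrows_block_starts[symmetric])
    show "(i, l) \<in> W" if "(i, j) \<in> W" "(j, l) \<in> W" for i j l
      using W3(1) W that by blast
  qed (use W refl convex in blast)+
  have avoid: "s \<notin> block_starts n W" if "(i, j) \<in> W" "i < s" "s \<le> j" for i j s
    using subsetD[OF equalityD1[OF WS] that(1)] that(2,3) unfolding block_arrows_def by auto
  show "blocked_transfer n 0 (block_starts n W) (W \<inter> F)"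
    unfolding blocked_transfer_def
  proof (intro conjI allI impI; (elim conjE)?)
    fix i j l assume "(i, j) \<in> W \<inter> F" "(j, l) \<in> W \<inter> F"
    then show "(i, l) \<in> W \<inter> F" using right_lifting_trans[where L = C and n = n, folded AF] by blast
  next
    fix i m j assume "(i, j) \<in> W \<inter> F" "i \<le> m" "m \<le> j"
    then show "(i, m) \<in> W \<inter> F" by (rule AF_pullback)
  next
    fix i assume "i \<le> n"
    then show "(i, i) \<in> W \<inter> F" using right_lifting_refl[of i n C] AF by blast
  qed (use W avoid in \<open>auto simp: block_starts_def\<close>)
  show "C = left_lifting n (W \<inter> F)" "F = right_lifting n (W \<inter> C)" by (rule C, rule F)
qed

lemma blocked_transfer_imp_model_structure:
  assumes v: "blocked_transfer n 0 S T"
  defines "W \<equiv> block_arrows n S" and "C \<equiv> left_lifting n T"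
  defines "F \<equiv> right_lifting n (W \<inter> C)"
  shows "model_structure (ordinal_cat n) W C F" "W \<inter> F = T"
proof -
  note D = blocked_transferD[OF v]
  have W: "i \<le> j" "j \<le> n" if "(i, j) \<in> W" for i j
    using that unfolding W_def block_arrows_def by blast+
  have W_split: "(i, l) \<in> W \<longleftrightarrow> (i, j) \<in> W \<and> (j, l) \<in> W" if "i \<le> j" "j \<le> l" "l \<le> n" for i j l
  proof -
    have "{i<..l} = {i<..j} \<union> {j<..l}" using that by auto
    then show ?thesis using that unfolding W_def block_arrows_def by auto
  qed
  have W_refl: "(i, i) \<in> W" if "i \<le> n" for i
    using that unfolding W_def block_arrows_def by simp
  have two: "two_out_of_three (ordinal_cat n) W"
    unfolding two_out_of_three_ordinal_cat using W_split by blast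
  have TW: "(i, j) \<in> W" if "(i, j) \<in> T" for i j
    using D(4,5,9)[OF that] unfolding W_def block_arrows_def by auto
  have T_C: "\<exists>m. i \<le> m \<and> m \<le> j \<and> (i, m) \<in> C \<and> (m, j) \<in> T" if "i \<le> j" "j \<le> n" for i j
  proof -
    \<comment> \<open>Taking \<open>m\<close> least makes the first factor a cofibration: an arrow
      of \<open>T\<close> from below \<open>m\<close> that violates the lifting pulls back to one
      ending at \<open>m\<close>, and its composite with \<open>(m, j)\<close> contradicts
      minimality.\<close>
    define m where "m = (LEAST m. i \<le> m \<and> (m, j) \<in> T)"
    have m: "i \<le> m \<and> (m, j) \<in> T"
      unfolding m_def by (rule LeastI[of _ j]) (use that D(6) in simp)
    have least: "m \<le> a" if "i \<le> a" "(a, j) \<in> T" for a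
      unfolding m_def by (rule Least_le) (use that in simp)
    have "(i, m) \<in> C"
      unfolding C_def
    proof (rule left_liftingI)
      show "i \<le> m" "m \<le> n" using m D(4,5)[of m j] by auto
      fix a b assume "(a, b) \<in> T" "i \<le> a" "m \<le> b"
      show "m \<le> a"
      proof (rule ccontr)
        assume "\<not> m \<le> a"
        then have "(a, m) \<in> T" using D(8)[OF \<open>(a, b) \<in> T\<close>] \<open>m \<le> b\<close> by simp
        then have "(a, j) \<in> T" using D(7) m by blast
        then show False using least \<open>i \<le> a\<close> \<open>\<not> m \<le> a\<close> by blast
      qed
    qed
    then show ?thesis using m D(4) by blast
  qed
  have FD: "j \<le> a" if "(a, b) \<in> F" "(i, j) \<in> W" "(i, j) \<in> C" "i \<le> a" "j \<le> b" for a b i j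
    using right_liftingD(3)[of a b n "W \<inter> C"] that unfolding F_def by blast
  have AF: "(a, b) \<in> W \<inter> F \<longleftrightarrow> (a, b) \<in> T" for a b
  proof
    assume ab: "(a, b) \<in> T"
    have "(a, b) \<in> F"
      unfolding F_def
      by (rule right_liftingI) (use D(4,5)[OF ab] left_liftingD(3)[OF _ ab] in \<open>auto simp: C_def\<close>)
    then show "(a, b) \<in> W \<inter> F" using TW[OF ab] by simp
  next
    assume ab: "(a, b) \<in> W \<inter> F"
    then have le: "a \<le> b" "b \<le> n" using W by blast+
    \<comment> \<open>Another retract argument: 2-out-of-3 makes the first factor an acyclic
      cofibration, and lifting it against \<open>(a, b)\<close> gives \<open>m = a\<close>.\<close>
    obtain m where m: "a \<le> m" "m \<le> b" "(a, m) \<in> C" "(m, b) \<in> T" using T_C[OF le] by blast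
    then have "(a, m) \<in> W" using W_split[OF m(1,2) le(2)] ab by blast
    then have "m \<le> a" using FD[of a b a m] ab m by blast
    then show "(a, b) \<in> T" using m by simp
  qed
  then show AF': "W \<inter> F = T" by (intro subset_antisym subrelI) blast+
  have F_AC: "\<exists>m. (i, m) \<in> W \<inter> C \<and> (m, j) \<in> F" if "i \<le> j" "j \<le> n" for i j
  proof -
    let ?M = "{m. m \<le> j \<and> (i, m) \<in> W \<inter> C}"
    \<comment> \<open>Dually, \<open>m\<close> is the furthest point up to \<open>j\<close> reached
      from \<open>i\<close> by an acyclic cofibration. One that violates the lifting is pushed out
      to start at \<open>m\<close>, and composing from \<open>i\<close> contradicts
      maximality.\<close>
    define m where "m = Max ?M"
    have "i \<in> ?M" using that W_refl left_lifting_refl unfolding C_def by auto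
    moreover have "finite ?M" by simp
    ultimately have m: "m \<le> j" "(i, m) \<in> W" "(i, m) \<in> C" and max: "\<And>d. d \<in> ?M \<Longrightarrow> d \<le> m"
      using Max_in[of ?M] Max_ge[of ?M] unfolding m_def by blast+
    have "(m, j) \<in> F"
      unfolding F_def
    proof (rule right_liftingI)
      fix c d assume cd: "(c, d) \<in> W \<inter> C" "c \<le> m" "d \<le> j"
      show "d \<le> m"
      proof (rule ccontr)
        assume "\<not> d \<le> m"
        then have "(m, d) \<in> W" "(m, d) \<in> C"
          using W_split[of c m d] left_lifting_pushout[of c d n T m] cd that(2) unfolding C_def by auto
        then have "(i, d) \<in> W" "(i, d) \<in> C"
          using W_split[of i m d] left_lifting_trans[of i m n T d] m W(1)[OF m(2)] \<open>\<not> d \<le> m\<close> cd(3) that(2)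
          unfolding C_def by auto
        then show False using max[of d] cd(3) \<open>\<not> d \<le> m\<close> by blast
      qed
    qed (use m that in auto)
    then show ?thesis using m by blast
  qed
  have "weak_factorization_system (ordinal_cat n) C (W \<inter> F)"
    unfolding AF'
  proof (rule weak_factorization_systemI)
    fix i j a b assume "(i, j) \<in> C" "(a, b) \<in> T" "i \<le> a" "j \<le> b"
    then show "j \<le> a" unfolding C_def by (rule left_liftingD(3))
  next
    show "i \<le> j \<and> j \<le> n" if "(i, j) \<in> C" for i j using left_liftingD(1,2) that unfolding C_def by blast
  qed (use T_C D(4,5) in blast)+
  moreover have "weak_factorization_system (ordinal_cat n) (W \<inter> C) F"
  proof (rule weak_factorization_systemI)
    show "i \<le> j \<and> j \<le> n" if "(i, j) \<in> F" for i j using right_liftingD(1,2) that unfolding F_def by blast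
  qed (use W F_AC FD in blast)+
  moreover have "W \<subseteq> Arr (ordinal_cat n)" using W by (auto simp: ordinal_cat_def)
  ultimately show "model_structure (ordinal_cat n) W C F"
    unfolding model_structure_ordinal_cat using two by blast
qed

lemma card_model_structures:
  "card {(W, Cof, Fib). model_structure (ordinal_cat n) W Cof Fib \<and>
     equivalent_categories (localization (ordinal_cat n) W) (ordinal_cat k)} =
   card (blocked_transfers n 0 (Suc k))"
proof -
  define f where "f = (\<lambda>(S, T). (block_arrows n S, left_lifting n T,
      right_lifting n (block_arrows n S \<inter> left_lifting n T)))"
  define g where "g = (\<lambda>(W :: (nat \<times> nat) set, C :: (nat \<times> nat) set, F). (block_starts n W, W \<inter> F))"
  let ?M = "{(W, Cof, Fib). model_structure (ordinal_cat n) W Cof Fib \<and>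
     equivalent_categories (localization (ordinal_cat n) W) (ordinal_cat k)}"
  have "f x \<in> ?M \<and> g (f x) = x" if x_in: "x \<in> blocked_transfers n 0 (Suc k)" for x
  proof -
    obtain S T where x: "x = (S, T)" and v: "blocked_transfer n 0 S T" and card: "card S = Suc k"
      using x_in by (cases x) (auto simp: blocked_transfers_def)
    have S: "S \<subseteq> {0..n}" "0 \<in> S" using blocked_transferD(1,2)[OF v] by auto
    show ?thesis
      using blocked_transfer_imp_model_structure[OF v] block_starts_block_arrows[OF S]
        homotopy_category_block_arrows[OF S, of k] card
      by (simp add: f_def g_def x)
  qed
  moreover have "g x \<in> blocked_transfers n 0 (Suc k) \<and> f (g x) = x" if x_in: "x \<in> ?M" for x
  proof -
    obtain W C F where x: "x = (W, C, F)" and M: "model_structure (ordinal_cat n) W C F"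
      and equiv: "equivalent_categories (localization (ordinal_cat n) W) (ordinal_cat k)"
      using x_in by (cases x) auto
    note B = model_structure_imp_blocked_transfer[OF M]
    have S: "block_starts n W \<subseteq> {0..n}" "0 \<in> block_starts n W"
      using blocked_transferD(1,2)[OF B(2)] by auto
    have "card (block_starts n W) = Suc k"
      using homotopy_category_block_arrows[OF S, of k, folded B(1)] equiv by simp
    then have "g x \<in> blocked_transfers n 0 (Suc k)"
      using B(2) by (simp add: g_def x blocked_transfers_def)
    moreover have "f (g x) = (W, C, F)"
      unfolding g_def f_def x case_prod_conv B(1,3)[symmetric] B(4)[symmetric] ..
    ultimately show ?thesis by (simp add: x)
  qed
  ultimately show ?thesis by (rule card_eq_witness)
qed

theorem theorem4p13:
  fixes n k :: nat
  assumes "k \<le> n"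
  shows "real (card {(W, Cof, Fib). model_structure (ordinal_cat n) W Cof Fib \<and>
            equivalent_categories (localization (ordinal_cat n) W) (ordinal_cat k)})
       = 2 * (real k + 1) / (real n + real k + 2) * real ((2 * n + 1) choose (n - k))"
  unfolding card_model_structures by (rule card_blocked_transfers[OF assms])

end
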